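(* Let $\gamma>0$. The class $\mathcal H^{\rm D}\mathcal I_\gamma^{\omega}$ is an (associative, not necessarily unital) algebra with respect to $*_\gamma$. Its subclass $\mathcal H^{\rm S}\mathcal I_\gamma^{\omega}$ is also an (associative, not necessarily unital) algebra, and it is a left ideal of $\mathcal H^{\rm D}\mathcal I_\gamma^{\omega}$.
   Context: Fix $0<q<1$. $[e]_q=\frac{1-q^e}{1-q}$, $[e]_q!=[1]_q\cdots[e]_q$. The $q$-derivative is $(\partial f)(x)=\frac{f(x)-f(qx)}{(1-q)x}$ for $x\ne0$; for functions holomorphic near $0$ its value at $0$ is given by analytic continuation. For $\gamma>0$ let $L(\gamma)=\{\pm q^k\gamma\mid k\in\mathbf Z\}$ and $\int_\gamma f=(1-q)\sum_{k\in\mathbf Z}\sum_{\epsilon=\pm1}q^k\gamma f(\epsilon q^k\gamma)$ when the sum converges absolutely. $\mathcal I_\gamma^\infty$ is the space of functions $f$ on $L(\gamma)$ such that for all $e\in\mathbf Z_{\ge0}$ this sum converges absolutely for $x\mapsto f(x)x^e$. For $f\in\mathcal I_\gamma^\infty$: $\mu_{e,\gamma}(f)=q^{(e^2+e)/2}\int_\gamma f(x)x^e$. $q$-convolution: $(f*_\gamma g)(x)=\sum_{e=0}^\infty\frac{(-1)^e\mu_{e,\gamma}(f)}{[e]_q!}(\partial^e g)(x)$, at points $x$ where all $(\partial^eg)(x)$ are defined and the series converges absolutely. $\mathcal I_\gamma^{\omega}$ is the set of $f\in\mathcal I_\gamma^\infty$ such that for some $\alpha,b>0$, $|\mu_{e,\gamma}(f)|=O(q^{\alpha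 e^2/2}b^e)$ as $e\to\infty$. $\mathcal H^{\rm D}\mathcal I_\gamma^{\omega}$: the $f\in\mathcal I_\gamma^{\omega}$ which coincide, at the points of $L(\gamma)$ in some disk centered at $0$, with a function holomorphic on that disk. $\mathcal H^{\rm S}\mathcal I_\gamma^{\omega}$: the $f\in\mathcal I_\gamma^{\omega}$ which are restrictions to $L(\gamma)$ of a function holomorphic on some strip $\{z\in\mathbf C\mid|{\rm Im}(z)|<a\}$, $a>0$. *)

theory Defs
  imports
    "HOL-Complex_Analysis.Complex_Analysis"
    "HOL-Library.Landau_Symbols"
    "HOL-Library.Function_Algebras"
begin

definition qnum :: "real \<Rightarrow> nat \<Rightarrow> real" where
  "qnum q e = (1 - q ^ e) / (1 - q)"

definition qfact :: "real \<Rightarrow> nat \<Rightarrow> real" where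
  "qfact q e = (\<Prod>i=1..e. qnum q i)"

text \<open>For a function holomorphic near 0 the difference quotient has a removable singularity
  at 0, so its analytic continuation is given by the limit.\<close>

definition qderiv :: "real \<Rightarrow> (complex \<Rightarrow> complex) \<Rightarrow> complex \<Rightarrow> complex" where
  "qderiv q f x =
    (if x = 0 then Lim (at 0) (\<lambda>y. (f y - f (of_real q * y)) / (of_real (1 - q) * y))
     else (f x - f (of_real q * x)) / (of_real (1 - q) * x))"

definition qpoint :: "real \<Rightarrow> real \<Rightarrow> int \<Rightarrow> real \<Rightarrow> real" where
  "qpoint q \<gamma> k \<epsilon> = \<epsilon> * q powi k * \<gamma>"

definition qlattice :: "real \<Rightarrow> real \<Rightarrow> complex set" where
  "qlattice q \<gamma> = {of_real (qpoint q \<gamma> k \<epsilon>) | k \<epsilon>. \<epsilon> \<in> {1, -1}}"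

text \<open>A function on a subset \<open>S\<close> of the complex plane is represented by its extension by 0,
  so that equality of functions on \<open>S\<close> is equality in HOL, and the pointwise
  vector space operations are those of the ambient function type.\<close>

definition funs_on :: "complex set \<Rightarrow> (complex \<Rightarrow> complex) set" where
  "funs_on S = {f. \<forall>x. x \<notin> S \<longrightarrow> f x = 0}"

definition qint_term :: "real \<Rightarrow> real \<Rightarrow> (complex \<Rightarrow> complex) \<Rightarrow> int \<times> real \<Rightarrow> complex" where
  "qint_term q \<gamma> f = (\<lambda>(k, \<epsilon>). of_real (q powi k * \<gamma>) * f (of_real (qpoint q \<gamma> k \<epsilon>)))"

definition qintegrable :: "real \<Rightarrow> real \<Rightarrow> (complex \<Rightarrow> complex) \<Rightarrow> bool" where
  "qintegrable q \<gamma> f \<longleftrightarrow> (\<lambda>p. norm (qint_term q \<gamma> f p)) summable_on (UNIV \<times> {1, -1})"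

definition qintegral :: "real \<Rightarrow> real \<Rightarrow> (complex \<Rightarrow> complex) \<Rightarrow> complex" where
  "qintegral q \<gamma> f = of_real (1 - q) * infsum (qint_term q \<gamma> f) (UNIV \<times> {1, -1})"

definition I_infty :: "real \<Rightarrow> real \<Rightarrow> (complex \<Rightarrow> complex) set" where
  "I_infty q \<gamma> = {f \<in> funs_on (qlattice q \<gamma>). \<forall>e::nat. qintegrable q \<gamma> (\<lambda>x. f x * x ^ e)}"

text \<open>The division in the exponent is exact, since \<open>e\<^sup>2 + e\<close> is even.\<close>

definition qmoment :: "real \<Rightarrow> real \<Rightarrow> nat \<Rightarrow> (complex \<Rightarrow> complex) \<Rightarrow> complex" where
  "qmoment q \<gamma> e f = of_real (q ^ ((e\<^sup>2 + e) div 2)) * qintegral q \<gamma> (\<lambda>x. f x * x ^ e)"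

definition qconv_term ::
  "real \<Rightarrow> real \<Rightarrow> (complex \<Rightarrow> complex) \<Rightarrow> (complex \<Rightarrow> complex) \<Rightarrow> complex \<Rightarrow> nat \<Rightarrow> complex" where
  "qconv_term q \<gamma> f g x e =
    (-1) ^ e * qmoment q \<gamma> e f / of_real (qfact q e) * (qderiv q ^^ e) g x"

text \<open>If \<open>g\<close> is a function on the lattice, all its iterated q-derivatives are defined at every
  point of the lattice (and involve only values on the lattice, which does not contain 0), so
  that on the lattice only the convergence of the series is in question.\<close>

definition qconv_converges ::
  "real \<Rightarrow> real \<Rightarrow> (complex \<Rightarrow> complex) \<Rightarrow> (complex \<Rightarrow> complex) \<Rightarrow> complex \<Rightarrow> bool" where
  "qconv_converges q \<gamma> f g x \<longleftrightarrow> summable (\<lambda>e. norm (qconv_term q \<gamma> f g x e))"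

text \<open>The q-convolution product as a function on the lattice; its value at a point is meaningful
  only if \<^const>\<open>qconv_converges\<close> holds there.\<close>

definition qconv ::
  "real \<Rightarrow> real \<Rightarrow> (complex \<Rightarrow> complex) \<Rightarrow> (complex \<Rightarrow> complex) \<Rightarrow> complex \<Rightarrow> complex" where
  "qconv q \<gamma> f g = (\<lambda>x. if x \<in> qlattice q \<gamma> then \<Sum>e. qconv_term q \<gamma> f g x e else 0)"

definition I_omega :: "real \<Rightarrow> real \<Rightarrow> (complex \<Rightarrow> complex) set" where
  "I_omega q \<gamma> = {f \<in> I_infty q \<gamma>. \<exists>\<alpha>>0. \<exists>b>0.
     (\<lambda>e. norm (qmoment q \<gamma> e f)) \<in> O(\<lambda>e. q powr (\<alpha> * (real e)\<^sup>2 / 2) * b ^ e)}"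

definition HD_I_omega :: "real \<Rightarrow> real \<Rightarrow> (complex \<Rightarrow> complex) set" where
  "HD_I_omega q \<gamma> = {f \<in> I_omega q \<gamma>. \<exists>r>0. \<exists>F. F holomorphic_on ball 0 r \<and>
     (\<forall>x \<in> qlattice q \<gamma> \<inter> ball 0 r. f x = F x)}"

definition HS_I_omega :: "real \<Rightarrow> real \<Rightarrow> (complex \<Rightarrow> complex) set" where
  "HS_I_omega q \<gamma> = {f \<in> I_omega q \<gamma>. \<exists>a>0. \<exists>F. F holomorphic_on {z. \<bar>Im z\<bar> < a} \<and>
     (\<forall>x \<in> qlattice q \<gamma>. f x = F x)}"

definition fun_scale :: "complex \<Rightarrow> (complex \<Rightarrow> complex) \<Rightarrow> complex \<Rightarrow> complex" where
  "fun_scale c f = (\<lambda>x. c * f x)"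

text \<open>Associative, not necessarily unital algebras carried by a subspace of a vector space; the
  multiplication need not be well behaved outside the carrier.\<close>

locale assoc_algebra = vector_space scale
  for scale :: "'k::field \<Rightarrow> 'v::ab_group_add \<Rightarrow> 'v" +
  fixes A :: "'v set" and mult :: "'v \<Rightarrow> 'v \<Rightarrow> 'v"
  assumes subspace_carrier: "subspace A"
    and mult_closed: "\<lbrakk>a \<in> A; b \<in> A\<rbrakk> \<Longrightarrow> mult a b \<in> A"
    and mult_add_left: "\<lbrakk>a \<in> A; b \<in> A; c \<in> A\<rbrakk> \<Longrightarrow> mult (a + b) c = mult a c + mult b c"
    and mult_add_right: "\<lbrakk>a \<in> A; b \<in> A; c \<in> A\<rbrakk> \<Longrightarrow> mult a (b + c) = mult a b + mult a c"
    and mult_scale_left: "\<lbrakk>a \<in> A; b \<in> A\<rbrakk> \<Longrightarrow> mult (scale r a) b = scale r (mult a b)"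
    and mult_scale_right: "\<lbrakk>a \<in> A; b \<in> A\<rbrakk> \<Longrightarrow> mult a (scale r b) = scale r (mult a b)"
    and mult_assoc: "\<lbrakk>a \<in> A; b \<in> A; c \<in> A\<rbrakk> \<Longrightarrow> mult (mult a b) c = mult a (mult b c)"

locale algebra_left_ideal = assoc_algebra scale A mult
  for scale :: "'k::field \<Rightarrow> 'v::ab_group_add \<Rightarrow> 'v" and A mult +
  fixes J :: "'v set"
  assumes subset_carrier: "J \<subseteq> A"
    and subspace_ideal: "subspace J"
    and mult_left_mem: "\<lbrakk>a \<in> A; j \<in> J\<rbrakk> \<Longrightarrow> mult a j \<in> J"

end

theory Submission
  imports Defs
begin

text \<open>
  Put \<open>a\<^sub>e(f) = (-1)\<^sup>e \<mu>\<^sub>e(f) / [e]!\<close> and let a sequence \<open>a\<close> act by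
  \<open>T\<^sub>a g = \<Sum>\<^sub>e a\<^sub>e \<partial>\<^sup>e g\<close>, so that \<open>f * g = T\<^sub>a g\<close> with \<open>a = a(f)\<close>. If \<open>g\<close> decays rapidly on the
  lattice and is holomorphic near the origin, the suprema of \<open>|x|\<^sup>N |\<partial>\<^sup>e g(x)|\<close> grow at most
  exponentially in \<open>e\<close>: near the origin by the maximum modulus principle, elsewhere directly from the
  recursion for \<open>\<partial>\<^sup>e\<close>. The Gaussian decay of \<open>a(f)\<close> beats every exponential, so the series may be
  differentiated and integrated term by term and converges locally uniformly wherever \<open>g\<close> extends
  holomorphically. Integration by parts says that \<open>\<partial>\<close> shifts \<open>a(g)\<close> by one place, hence \<open>a(f * g)\<close> is
  the Cauchy product of \<open>a(f)\<close> and \<open>a(g)\<close>. Associativity is then the statement that Cauchy products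
  act by composition.
\<close>

section \<open>Sums and sequences\<close>

text \<open>Domination by a product of two summable families gives absolute convergence over the
  product set. This is the Fubini hypothesis for the two later interchanges: series with integral,
  and series with series.\<close>

lemma summable_on_product_bound:
  fixes t :: "'a \<Rightarrow> 'b \<Rightarrow> complex" and w :: "'a \<Rightarrow> real" and c :: "'b \<Rightarrow> real"
  assumes w: "w summable_on A" "\<And>x. 0 \<le> w x" and c: "c summable_on B" "\<And>y. 0 \<le> c y"
    and bound: "\<And>x y. x \<in> A \<Longrightarrow> y \<in> B \<Longrightarrow> norm (t x y) \<le> w x * c y"
  shows "(\<lambda>(x, y). t x y) summable_on A \<times> B"
proof -
  have norm_eq: "norm (w x * c y) = w x * c y" for x y
    using w(2)[of x] c(2)[of y] by simp
  have "(\<lambda>z. norm ((\<lambda>(x, y). w x * c y) z)) summable_on A \<times> B"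
  proof (subst Infinite_Sum.abs_summable_on_Sigma_iff, intro conjI ballI)
    show "(\<lambda>y. norm (case (x, y) of (x, y) \<Rightarrow> w x * c y)) summable_on B" for x
      unfolding prod.case norm_eq using c(1) by (rule summable_on_cmult_right)
    have "(\<lambda>x. w x * infsum c B) summable_on A"
      using w(1) by (rule summable_on_cmult_left)
    moreover have "norm (w x * infsum c B) = w x * infsum c B" for x
      using w(2)[of x] infsum_nonneg[of B c] c(2) by simp
    ultimately show "(\<lambda>x. norm (infsum (\<lambda>y. norm (case (x, y) of (x, y) \<Rightarrow> w x * c y)) B)) summable_on A"
      unfolding prod.case norm_eq infsum_cmult_right' by simp
  qed
  then have "(\<lambda>z. norm ((\<lambda>(x, y). t x y) z)) summable_on A \<times> B"
  proof (rule Infinite_Sum.abs_summable_on_comparison_test)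
    fix z assume "z \<in> A \<times> B"
    then have "norm (t (fst z) (snd z)) \<le> w (fst z) * c (snd z)"
      by (intro bound) auto
    also have "\<dots> \<le> norm (w (fst z) * c (snd z))" by simp
    finally show "norm ((\<lambda>(x, y). t x y) z) \<le> norm ((\<lambda>(x, y). w x * c y) z)"
      by (simp add: case_prod_beta)
  qed
  then show ?thesis by (rule abs_summable_summable)
qed

lemma infsum_nat_suminf:
  fixes f :: "nat \<Rightarrow> complex"
  assumes "f summable_on UNIV"
  shows "f sums infsum f UNIV" "infsum f UNIV = suminf f"
proof -
  show "f sums infsum f UNIV"
    using assms by (intro has_sum_imp_sums has_sum_infsum)
  then show "infsum f UNIV = suminf f" by (rule sums_unique)
qed

lemma telescope_int:
  fixes u :: "int \<Rightarrow> complex"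
  shows "(\<Sum>k\<in>{- int n..int n}. u k - u (k + 1)) = u (- int n) - u (int n + 1)"
proof (induction n)
  case (Suc n)
  have "{- int (Suc n)..int (Suc n)} = insert (- 1 - int n) (insert (int n + 1) {- int n..int n})" by auto
  then show ?case using Suc by (simp add: algebra_simps)
qed simp

text \<open>The \<open>e\<close>-th q-derivative grows at most like \<open>D ^ e\<close> with a
  \<open>D\<close> that depends on the function, so the coefficients have to be summable against
  every geometric sequence. All convergence arguments use only this; the Gaussian form matters for
  closure of the classes.\<close>

definition superexp :: "(nat \<Rightarrow> complex) \<Rightarrow> bool" where
  "superexp a \<longleftrightarrow> (\<forall>D>0. summable (\<lambda>e. norm (a e) * D ^ e))"

lemma superexp_summable:
  assumes "superexp a" "0 < D" "\<And>e. norm (c e) \<le> M * D ^ e"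
  shows "summable (\<lambda>e. norm (a e * c e))"
proof (rule summable_comparison_test')
  show "summable (\<lambda>e. M * (norm (a e) * D ^ e))"
    using assms unfolding superexp_def by (intro summable_mult) blast
  show "norm (norm (a n * c n)) \<le> M * (norm (a n) * D ^ n)" for n
    using mult_left_mono[OF assms(3), of "norm (a n)" n] by (simp add: norm_mult mult_ac)
qed

section \<open>Gaussian decay and Cauchy products\<close>

definition cauchy :: "(nat \<Rightarrow> complex) \<Rightarrow> (nat \<Rightarrow> complex) \<Rightarrow> nat \<Rightarrow> complex" where
  "cauchy a b n = (\<Sum>e\<le>n. a e * b (n - e))"

text \<open>An arbitrary base \<open>p\<close> in place of a power of \<open>q\<close>, and a bound
  for every \<open>e\<close> in place of an asymptotic one, make the estimates purely algebraic. The
  link with the O-condition is \<open>gaussian_iff_bigo\<close>.\<close>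

definition gaussian :: "(nat \<Rightarrow> complex) \<Rightarrow> bool" where
  "gaussian a \<longleftrightarrow> (\<exists>p b C. 0 < p \<and> p < 1 \<and> 0 < b \<and> 0 \<le> C \<and> (\<forall>e. norm (a e) \<le> C * p ^ (e * e) * b ^ e))"

lemma gaussianI:
  fixes p b C :: real
  assumes "0 < p" "p < 1" "0 < b" "0 \<le> C" "\<And>e. norm (a e) \<le> C * p ^ (e * e) * b ^ e"
  shows "gaussian a"
  using assms unfolding gaussian_def by blast

text \<open>The bound is monotone in each of \<open>p\<close>, \<open>b\<close> and
  \<open>C\<close>, so maxima serve both sequences.\<close>

lemma gaussianE2:
  assumes "gaussian a" "gaussian a'"
  obtains p b C :: real where "0 < p" "p < 1" "0 < b" "0 \<le> C"
    "\<And>e. norm (a e) \<le> C * p ^ (e * e) * b ^ e" "\<And>e. norm (a' e) \<le> C * p ^ (e * e) * b ^ e"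
proof -
  obtain p b C where 1: "0 < p" "p < 1" "0 < b" "0 \<le> C" "\<And>e. norm (a e) \<le> C * p ^ (e * e) * b ^ e"
    using assms(1) unfolding gaussian_def by metis
  obtain p' b' C' where 2: "0 < p'" "p' < 1" "0 < b'" "0 \<le> C'" "\<And>e. norm (a' e) \<le> C' * p' ^ (e * e) * b' ^ e"
    using assms(2) unfolding gaussian_def by metis
  have "C * p ^ (e * e) * b ^ e \<le> max C C' * max p p' ^ (e * e) * max b b' ^ e" for e
    using 1(1-4) by (intro mult_mono power_mono) auto
  note le1 = order_trans[OF 1(5) this]
  have "C' * p' ^ (e * e) * b' ^ e \<le> max C C' * max p p' ^ (e * e) * max b b' ^ e" for e
    using 2(1-4) by (intro mult_mono power_mono) auto
  note le2 = order_trans[OF 2(5) this]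
  show ?thesis
    by (rule that[of "max p p'" "max b b'" "max C C'", OF _ _ _ _ le1 le2]) (use 1 2 in auto)
qed

text \<open>Since \<open>p ^ (e * e) * (b * D) ^ e\<close> is the \<open>e\<close>-th power of
  \<open>p ^ e * (b * D)\<close>, whose limit is 0, the terms are eventually below a geometric
  sequence of ratio 1/2.\<close>

lemma gaussian_superexp:
  assumes "gaussian a"
  shows "superexp a"
  unfolding superexp_def
proof (intro allI impI)
  fix D :: real assume "0 < D"
  obtain p b C where a: "0 < p" "p < 1" "0 < b" "0 \<le> C" "\<And>e. norm (a e) \<le> C * p ^ (e * e) * b ^ e"
    using assms unfolding gaussian_def by metis
  have "(\<lambda>e. p ^ e * (b * D)) \<longlonglongrightarrow> 0"
    using a by (intro tendsto_mult_left_zero LIMSEQ_realpow_zero) auto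
  then have "eventually (\<lambda>e. p ^ e * (b * D) < 1 / 2) sequentially"
    by (rule order_tendstoD) simp
  then have "eventually (\<lambda>e. norm (norm (a e) * D ^ e) \<le> C * (1 / 2) ^ e) sequentially"
  proof eventually_elim
    case (elim e)
    have "norm (a e) * D ^ e \<le> (C * p ^ (e * e) * b ^ e) * D ^ e"
      using a(5) \<open>0 < D\<close> by (intro mult_right_mono) auto
    also have "\<dots> = C * (p ^ e * (b * D)) ^ e"
      by (simp add: power_mult power_mult_distrib)
    also have "\<dots> \<le> C * (1 / 2) ^ e"
      using a elim \<open>0 < D\<close> by (intro mult_left_mono power_mono) auto
    finally show ?case using \<open>0 < D\<close> by simp
  qed
  then show "summable (\<lambda>e. norm (a e) * D ^ e)"
    by (rule summable_comparison_test_ev) (intro summable_mult summable_geometric, simp)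
qed

lemma gaussian_add:
  assumes "gaussian a" "gaussian a'"
  shows "gaussian (\<lambda>e. a e + a' e)"
proof -
  obtain p b C :: real where a: "0 < p" "p < 1" "0 < b" "0 \<le> C"
    "\<And>e. norm (a e) \<le> C * p ^ (e * e) * b ^ e" "\<And>e. norm (a' e) \<le> C * p ^ (e * e) * b ^ e"
    using gaussianE2[OF assms] by metis
  show ?thesis
  proof (rule gaussianI[OF a(1-3), of "2 * C"])
    show "norm (a e + a' e) \<le> 2 * C * p ^ (e * e) * b ^ e" for e
      using norm_triangle_ineq[of "a e" "a' e"] a(5,6)[of e] by simp
  qed (use a in simp)
qed

lemma gaussian_mult_exp:
  assumes "gaussian a" "0 < D" "\<And>e. norm (a' e) \<le> K * D ^ e * norm (a e)"
  shows "gaussian a'"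
proof -
  obtain p b C where a: "0 < p" "p < 1" "0 < b" "0 \<le> C" "\<And>e. norm (a e) \<le> C * p ^ (e * e) * b ^ e"
    using assms unfolding gaussian_def by metis
  \<comment> \<open>The sign of \<open>K\<close> is left open, so its absolute value enters the
    constant.\<close>
  show ?thesis
  proof (rule gaussianI[of p "D * b" "\<bar>K\<bar> * C"])
    fix e
    have "norm (a' e) \<le> \<bar>K\<bar> * D ^ e * norm (a e)"
      using assms(2) by (intro order_trans[OF assms(3)] mult_right_mono) auto
    also have "\<dots> \<le> \<bar>K\<bar> * D ^ e * (C * p ^ (e * e) * b ^ e)"
      using a(5) assms(2) by (intro mult_left_mono) auto
    finally show "norm (a' e) \<le> \<bar>K\<bar> * C * p ^ (e * e) * (D * b) ^ e"
      by (simp add: power_mult_distrib mult_ac)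
  qed (use a assms(2) in auto)
qed

text \<open>Since \<open>n\<^sup>2 \<le> 2 (e\<^sup>2 + (n - e)\<^sup>2)\<close>, the square root of the base suffices.\<close>

lemma gaussian_cauchy:
  assumes "gaussian a" "gaussian a'"
  shows "gaussian (cauchy a a')"
proof -
  obtain p b C :: real where a: "0 < p" "p < 1" "0 < b" "0 \<le> C"
    "\<And>e. norm (a e) \<le> C * p ^ (e * e) * b ^ e" "\<And>e. norm (a' e) \<le> C * p ^ (e * e) * b ^ e"
    using gaussianE2[OF assms] by metis
  define s where "s = sqrt p"
  have s: "0 < s" "s < 1" "p = s ^ 2" using a(1,2) by (auto simp: s_def)
  show ?thesis
  proof (rule gaussianI[OF s(1,2), of "2 * b" "C * C"])
    fix n
    have "norm (cauchy a a' n) \<le> (\<Sum>e\<le>n. norm (a e * a' (n - e)))"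
      unfolding cauchy_def by (rule norm_sum)
    also have "\<dots> \<le> (\<Sum>e\<le>n. C * C * s ^ (n * n) * b ^ n)"
    proof (rule sum_mono)
      fix e assume "e \<in> {..n}"
      then obtain m where m: "n = e + m" using le_Suc_ex by auto
      have "2 * (e * m) \<le> e * e + m * m"
      proof -
        have "real (2 * (e * m)) \<le> real (e * e + m * m)"
          using sum_squares_bound[of "real e" "real m"] by (simp add: power2_eq_square)
        then show ?thesis by (simp only: of_nat_le_iff)
      qed
      then have "n * n \<le> 2 * (e * e) + 2 * (m * m)" by (simp add: m algebra_simps)
      then have pow: "s ^ (2 * (e * e)) * s ^ (2 * (m * m)) \<le> s ^ (n * n)"
        using s(1,2) unfolding power_add[symmetric] by (intro power_decreasing) auto
      have "norm (a e * a' (n - e)) \<le> (C * p ^ (e * e) * b ^ e) * (C * p ^ (m * m) * b ^ m)"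
        unfolding norm_mult using a m by (intro mult_mono) auto
      also have "\<dots> = C * C * (s ^ (2 * (e * e)) * s ^ (2 * (m * m))) * b ^ n"
        unfolding s(3) m by (simp add: power_add mult_ac flip: power_mult)
      also have "\<dots> \<le> C * C * s ^ (n * n) * b ^ n"
        using pow a by (intro mult_right_mono mult_left_mono) auto
      finally show "norm (a e * a' (n - e)) \<le> C * C * s ^ (n * n) * b ^ n" .
    qed
    also have "\<dots> = real (Suc n) * (C * C * s ^ (n * n) * b ^ n)" by simp
    \<comment> \<open>The number \<open>n + 1\<close> of summands is absorbed into the exponential
      factor, turning \<open>b\<close> into \<open>2 * b\<close>.\<close>
    also have "\<dots> \<le> 2 ^ n * (C * C * s ^ (n * n) * b ^ n)"
    proof (rule mult_right_mono)
      have "Suc n \<le> 2 ^ n" by (simp add: Suc_leI)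
      then show "real (Suc n) \<le> 2 ^ n" by (metis of_nat_le_iff of_nat_numeral of_nat_power)
    qed (use a s in auto)
    finally show "norm (cauchy a a' n) \<le> C * C * s ^ (n * n) * (2 * b) ^ n"
      by (simp add: power_mult_distrib mult_ac)
  qed (use a in auto)
qed

section \<open>The q-lattice\<close>

locale q_lattice =
  fixes q \<gamma> :: real
  assumes q_pos: "0 < q" and q_less_1: "q < 1" and \<gamma>_pos: "0 < \<gamma>"
begin

abbreviation L :: "complex set" where "L \<equiv> qlattice q \<gamma>"

abbreviation iter_deriv :: "nat \<Rightarrow> (complex \<Rightarrow> complex) \<Rightarrow> complex \<Rightarrow> complex" where
  "iter_deriv e \<equiv> qderiv q ^^ e"

definition rapid :: "(complex \<Rightarrow> complex) \<Rightarrow> bool" where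
  "rapid g \<longleftrightarrow> (\<forall>N::nat. \<exists>C. \<forall>x\<in>L. norm x ^ N * norm (g x) \<le> C)"

text \<open>The set is a parameter so that disks and strips are handled by the same lemmas; what
  these need of it is to be open, convex and to contain 0.\<close>

definition extends :: "complex set \<Rightarrow> (complex \<Rightarrow> complex) \<Rightarrow> bool" where
  "extends S g \<longleftrightarrow> (\<exists>F. F holomorphic_on S \<and> (\<forall>x\<in>L \<inter> S. g x = F x))"

text \<open>The class on which the analysis takes place: decay makes all moments converge,
  holomorphy near 0 controls the q-derivatives where the denominators become small. It is stable
  under q-differentiation and under \<open>qop\<close> with superexponentially decaying
  coefficients.\<close>

definition nice :: "(complex \<Rightarrow> complex) \<Rightarrow> bool" where
  "nice g \<longleftrightarrow> rapid g \<and> (\<exists>r>0. extends (ball 0 r) g)"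

definition qop :: "(nat \<Rightarrow> complex) \<Rightarrow> (complex \<Rightarrow> complex) \<Rightarrow> complex \<Rightarrow> complex" where
  "qop a g x = (\<Sum>e. a e * iter_deriv e g x)"

lemma norm_qpoint:
  assumes "\<epsilon> \<in> {1, -1}"
  shows "norm (complex_of_real (qpoint q \<gamma> k \<epsilon>)) = q powi k * \<gamma>"
  using assms q_pos \<gamma>_pos by (auto simp: qpoint_def norm_mult norm_power_int)

lemma qpoint_in_lattice: "\<epsilon> \<in> {1, -1} \<Longrightarrow> complex_of_real (qpoint q \<gamma> k \<epsilon>) \<in> L"
  unfolding qlattice_def by blast

lemma of_real_qpoint_Suc:
  "complex_of_real (qpoint q \<gamma> (k + 1) \<epsilon>) = of_real q * of_real (qpoint q \<gamma> k \<epsilon>)"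
  using q_pos by (simp add: qpoint_def power_int_add_1 mult_ac)

lemma lattice_cases:
  assumes "x \<in> L"
  obtains k \<epsilon> where "\<epsilon> \<in> {1, -1}" "x = of_real (qpoint q \<gamma> k \<epsilon>)"
  using assms unfolding qlattice_def by blast

lemma lattice_mult_q:
  assumes "x \<in> L"
  shows "of_real q * x \<in> L"
proof -
  obtain k \<epsilon> where "\<epsilon> \<in> {1, -1}" "x = of_real (qpoint q \<gamma> k \<epsilon>)"
    using assms by (rule lattice_cases)
  then show ?thesis
    using qpoint_in_lattice[of \<epsilon> "k + 1"] by (simp add: of_real_qpoint_Suc)
qed

lemma lattice_nonzero: "x \<in> L \<Longrightarrow> x \<noteq> 0"
  using q_pos \<gamma>_pos by (auto simp: qlattice_def qpoint_def)

lemma lattice_real: "x \<in> L \<Longrightarrow> Im x = 0"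
  by (auto simp: qlattice_def)

section \<open>Iterated q-derivatives\<close>

lemma qderiv_nonzero:
  "x \<noteq> 0 \<Longrightarrow> qderiv q g x = (g x - g (of_real q * x)) / (of_real (1 - q) * x)"
  by (simp add: qderiv_def)

text \<open>Away from 0 a q-derivative sees only the values at \<open>x\<close> and
  \<open>q * x\<close>, so a set stable under multiplication by \<open>q\<close> and avoiding 0
  determines all iterates. This transfers statements between a lattice function and its holomorphic
  extension.\<close>

lemma iter_deriv_cong:
  assumes closed: "\<And>x. x \<in> T \<Longrightarrow> of_real q * x \<in> T" and "0 \<notin> T"
    and eq: "\<And>x. x \<in> T \<Longrightarrow> f x = g x" and "x \<in> T"
  shows "iter_deriv e f x = iter_deriv e g x"
  using \<open>x \<in> T\<close>
proof (induction e arbitrary: x)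
  case (Suc e)
  moreover have "x \<noteq> 0" using Suc.prems \<open>0 \<notin> T\<close> by auto
  ultimately show ?case using closed by (simp add: qderiv_nonzero)
qed (simp add: eq)

text \<open>The point \<open>q * x\<close> lies on the segment from 0 to \<open>x\<close>.\<close>

lemma convex_mult_q: "convex S \<Longrightarrow> 0 \<in> S \<Longrightarrow> x \<in> S \<Longrightarrow> of_real q * x \<in> S"
  using convexD[of S 0 x "1 - q" q] q_pos q_less_1 by (simp add: scaleR_conv_of_real)

text \<open>The numerator vanishes at 0, so the quotient has a removable singularity there; the
  limit in \<open>qderiv\<close> is the derivative of the numerator (scaled by
  \<open>1 / (1 - q)\<close>), which is the value that removes it.\<close>

lemma holomorphic_on_qderiv:
  assumes hol: "F holomorphic_on S" and S: "open S" "0 \<in> S"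
    and closed: "\<And>x. x \<in> S \<Longrightarrow> of_real q * x \<in> S"
  shows "qderiv q F holomorphic_on S"
proof (rule pole_theorem_open_0[where a = 0])
  define G where "G y = (F y - F (of_real q * y)) / of_real (1 - q)" for y
  have "(\<lambda>y. F (of_real q * y)) holomorphic_on S"
    using holomorphic_on_compose_gen[of "\<lambda>y. of_real q * y" S F S] hol closed
    by (auto simp: o_def intro!: holomorphic_intros)
  then show G: "G holomorphic_on S"
    unfolding G_def using hol q_less_1 by (auto intro!: holomorphic_intros)
  show "G 0 = 0" by (simp add: G_def)
  show "open S" by (fact S)
  have "(G has_field_derivative deriv G 0) (at 0)"
    using holomorphic_derivI[OF G S] .
  then have "((\<lambda>h. G h / h) \<longlongrightarrow> deriv G 0) (at 0)"
    by (simp add: DERIV_def \<open>G 0 = 0\<close>)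
  then show "qderiv q F 0 = deriv G 0"
    unfolding qderiv_def G_def by (simp add: tendsto_Lim)
  show "G z = (z - 0) * qderiv q F z" if "z \<in> S - {0}" for z
    using that q_less_1 by (simp add: qderiv_nonzero G_def field_simps)
qed

lemma holomorphic_on_iter_deriv:
  assumes "F holomorphic_on S" "open S" "0 \<in> S" "\<And>x. x \<in> S \<Longrightarrow> of_real q * x \<in> S"
  shows "iter_deriv e F holomorphic_on S"
  using assms by (induction e) (auto intro: holomorphic_on_qderiv)

section \<open>Bounds exponential in the order of the q-derivative\<close>

text \<open>Maximum modulus avoids any estimate of the difference quotient near its
  removable singularity.\<close>

lemma iter_deriv_bound_cball:
  assumes "F holomorphic_on S" "open S" "cball 0 \<rho> \<subseteq> S" "0 < \<rho>"
    and "\<And>x. x \<in> S \<Longrightarrow> of_real q * x \<in> S"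
    and "\<And>z. z \<in> cball 0 \<rho> \<Longrightarrow> norm (F z) \<le> M"
    and "z \<in> cball 0 \<rho>"
  shows "norm (iter_deriv e F z) \<le> M * (2 / ((1 - q) * \<rho>)) ^ e"
  using assms
proof (induction e arbitrary: F M z)
  case (Suc e)
  define D where "D = 2 / ((1 - q) * \<rho>)"
  have hol: "qderiv q F holomorphic_on S"
    using Suc.prems by (intro holomorphic_on_qderiv) auto
  have bound: "norm (qderiv q F w) \<le> M * D" if w: "w \<in> cball 0 \<rho>" for w
  \<comment> \<open>On the boundary circle the denominator has modulus
    \<open>(1 - q) * \<rho>\<close>, while both values in the numerator are taken in the closed disk
    and are bounded by \<open>M\<close>.\<close>
  proof (rule maximum_modulus_frontier[of "qderiv q F" "cball 0 \<rho>"])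
    show "qderiv q F holomorphic_on interior (cball 0 \<rho>)"
      using hol Suc.prems(3) interior_subset holomorphic_on_subset by (metis subset_trans)
    show "continuous_on (closure (cball 0 \<rho>)) (qderiv q F)"
      using holomorphic_on_imp_continuous_on[OF hol] Suc.prems(3) continuous_on_subset
      by (metis closed_cball closure_closed)
    fix y :: complex assume "y \<in> frontier (cball 0 \<rho>)"
    then have y: "norm y = \<rho>" using \<open>0 < \<rho>\<close> by simp
    then have "y \<noteq> 0" using \<open>0 < \<rho>\<close> by auto
    have "norm (of_real q * y) \<le> \<rho>"
      using y q_pos q_less_1 \<open>0 < \<rho>\<close> by (simp add: norm_mult mult_left_le_one_le)
    then have "norm (F y - F (of_real q * y)) \<le> M + M"
      using y by (intro order.trans[OF norm_triangle_ineq4] add_mono Suc.prems) auto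
    then show "norm (qderiv q F y) \<le> M * D"
      using y q_less_1 \<open>0 < \<rho>\<close> \<open>y \<noteq> 0\<close>
      by (simp add: qderiv_nonzero norm_divide norm_mult D_def divide_right_mono flip: of_real_diff)
  qed (use w in auto)
  show ?case
    \<comment> \<open>The first derivative is split off on the inside: the induction hypothesis is
      applied to \<open>qderiv q F\<close> with \<open>M * D\<close> in place of
      \<open>M\<close>.\<close>
    using Suc.IH[OF hol Suc.prems(2-5) bound Suc.prems(7)]
    unfolding funpow_Suc_right o_apply by (simp add: D_def mult_ac)
qed simp

text \<open>Where \<open>norm x\<close> is at least \<open>\<rho>\<close> the denominator is bounded
  below and the recursion can be iterated directly. The value at \<open>q * x\<close> costs the
  factor \<open>1 / q ^ N\<close>, because the weight there is smaller by \<open>q ^ N\<close>. The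
  set is arbitrary as it is used both for the lattice and for a compact convex set.\<close>

lemma iter_deriv_bound:
  assumes closed: "\<And>x. x \<in> S \<Longrightarrow> of_real q * x \<in> S"
    and "0 < \<rho>" and D: "(1 + 1 / q ^ N) / ((1 - q) * \<rho>) \<le> D"
    and near: "\<And>e x. x \<in> S \<Longrightarrow> norm x < \<rho> \<Longrightarrow> norm x ^ N * norm (iter_deriv e g x) \<le> M * D ^ e"
    and bound: "\<And>x. x \<in> S \<Longrightarrow> norm x ^ N * norm (g x) \<le> M"
    and "x \<in> S"
  shows "norm x ^ N * norm (iter_deriv e g x) \<le> M * D ^ e"
  using \<open>x \<in> S\<close>
proof (induction e arbitrary: x)
  case (Suc e)
  show ?case
  proof (cases "norm x < \<rho>")
    case True
    then show ?thesis using near Suc.prems by blast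
  next
    case False
    then have x: "\<rho> \<le> norm x" "x \<noteq> 0" using \<open>0 < \<rho>\<close> by auto
    define A B where "A = norm (iter_deriv e g x)" and "B = norm (iter_deriv e g (of_real q * x))"
    have "0 \<le> M" using bound[OF Suc.prems] by (meson norm_ge_zero order_trans mult_nonneg_nonneg zero_le_power)
    have "0 \<le> D"
      by (rule order_trans[OF _ D]) (use q_pos q_less_1 \<open>0 < \<rho>\<close> in auto)
    have "norm x ^ N * A \<le> M * D ^ e" unfolding A_def by (rule Suc.IH[OF Suc.prems])
    moreover have "norm x ^ N * B \<le> 1 / q ^ N * (M * D ^ e)"
      using Suc.IH[OF closed[OF Suc.prems]] q_pos
      by (simp add: B_def norm_mult power_mult_distrib field_simps)
    ultimately have AB: "norm x ^ N * (A + B) \<le> (1 + 1 / q ^ N) * (M * D ^ e)"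
      by (simp add: algebra_simps)
    have "norm (iter_deriv (Suc e) g x) \<le> (A + B) / ((1 - q) * norm x)"
      using x q_less_1 norm_triangle_ineq4[of "iter_deriv e g x" "iter_deriv e g (of_real q * x)"]
      by (simp add: qderiv_nonzero norm_divide norm_mult A_def B_def divide_right_mono flip: of_real_diff)
    then have "norm x ^ N * norm (iter_deriv (Suc e) g x) \<le> norm x ^ N * ((A + B) / ((1 - q) * norm x))"
      by (intro mult_left_mono) auto
    also have "\<dots> = (norm x ^ N * (A + B)) / ((1 - q) * norm x)" by simp
    also have "\<dots> \<le> ((1 + 1 / q ^ N) * (M * D ^ e)) / ((1 - q) * \<rho>)"
    proof (rule frac_le)
      show "0 \<le> (1 + 1 / q ^ N) * (M * D ^ e)" using \<open>0 \<le> M\<close> \<open>0 \<le> D\<close> q_pos by simp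
    qed (use AB x q_less_1 \<open>0 < \<rho>\<close> in auto)
    also have "\<dots> = (1 + 1 / q ^ N) / ((1 - q) * \<rho>) * (M * D ^ e)" by simp
    also have "\<dots> \<le> D * (M * D ^ e)"
      using \<open>0 \<le> M\<close> \<open>0 \<le> D\<close> by (intro mult_right_mono D) auto
    finally show ?thesis by (simp add: mult_ac)
  qed
qed (simp add: bound)

text \<open>The same \<open>M\<close> and \<open>D\<close> serve all orders and all lattice points,
  though they depend on \<open>N\<close>. Inside the radius \<open>\<rho>\<close> the bound comes
  from the holomorphic extension, outside from the recursion.\<close>

lemma nice_iter_deriv_bound:
  assumes "nice g"
  obtains M D where "0 \<le> M" "0 < D"
    "\<And>e x. x \<in> L \<Longrightarrow> norm x ^ N * norm (iter_deriv e g x) \<le> M * D ^ e"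
proof -
  obtain r F where r: "r > 0" and F: "F holomorphic_on ball 0 r" "\<And>x. x \<in> L \<inter> ball 0 r \<Longrightarrow> g x = F x"
    using assms unfolding nice_def extends_def by blast
  obtain C where C: "\<And>x. x \<in> L \<Longrightarrow> norm x ^ N * norm (g x) \<le> C"
    using assms unfolding nice_def rapid_def by blast
  \<comment> \<open>Half of \<open>r\<close> keeps the closed disk inside the domain of
    \<open>F\<close>; the bound by 1 makes the weight \<open>norm x ^ N\<close> at most 1 on
    it.\<close>
  define \<rho> where "\<rho> = min (r / 2) 1"
  have \<rho>: "0 < \<rho>" "\<rho> \<le> 1" "cball 0 \<rho> \<subseteq> ball (0::complex) r" using r by (auto simp: \<rho>_def)
  have qball: "of_real q * x \<in> ball (0::complex) r" if "x \<in> ball 0 r" for x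
    using that r convex_mult_q[of "ball 0 r" x] by simp
  have "compact (F ` cball 0 \<rho>)"
    using F(1) \<rho>(3) by (intro compact_continuous_image holomorphic_on_imp_continuous_on)
      (auto intro: holomorphic_on_subset)
  then obtain M0 where M0: "\<And>z. z \<in> cball 0 \<rho> \<Longrightarrow> norm (F z) \<le> M0"
    by (meson bounded_iff compact_imp_bounded imageI)
  define M where "M = max 0 (max M0 C)"
  define D where "D = (1 + 1 / q ^ N) / ((1 - q) * \<rho>)"
  \<comment> \<open>As \<open>1 / q ^ N\<close> is at least 1, the far rate \<open>D\<close> also
    dominates the rate \<open>2 / ((1 - q) * \<rho>)\<close> valid in the disk.\<close>
  have "0 < D" unfolding D_def using q_pos q_less_1 \<rho> by (auto intro!: divide_pos_pos add_pos_pos)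
  have "2 / ((1 - q) * \<rho>) \<le> D"
    unfolding D_def using q_pos q_less_1 \<rho> by (intro divide_right_mono) (auto simp: power_le_one)
  have FM: "norm (F z) \<le> M" if "z \<in> cball 0 \<rho>" for z
    using M0[OF that] by (simp add: M_def)
  have near: "norm x ^ N * norm (iter_deriv e g x) \<le> M * D ^ e" if x: "x \<in> L" "norm x < \<rho>" for e x
  proof -
    have "iter_deriv e g x = iter_deriv e F x"
    proof (rule iter_deriv_cong[where T = "L \<inter> ball 0 r"])
      show "x \<in> L \<inter> ball 0 r" using x r by (auto simp: \<rho>_def)
    qed (use F(2) qball lattice_mult_q lattice_nonzero in auto)
    moreover have "norm (iter_deriv e F x) \<le> M * (2 / ((1 - q) * \<rho>)) ^ e"
      using x \<rho> FM qball by (intro iter_deriv_bound_cball[OF F(1)]) auto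
    moreover have "M * (2 / ((1 - q) * \<rho>)) ^ e \<le> M * D ^ e"
      using \<open>2 / ((1 - q) * \<rho>) \<le> D\<close> \<rho> q_less_1 by (intro mult_left_mono power_mono) (auto simp: M_def)
    moreover have "norm x ^ N \<le> 1" using x \<rho> by (intro power_le_one) auto
    ultimately show ?thesis
      using mult_mono[of "norm x ^ N" 1 "norm (iter_deriv e g x)" "M * D ^ e"] by simp
  qed
  show ?thesis
  proof
    show "norm x ^ N * norm (iter_deriv e g x) \<le> M * D ^ e" if "x \<in> L" for e x
    proof (rule iter_deriv_bound[where S = L and \<rho> = \<rho>])
      show "norm y ^ N * norm (g y) \<le> M" if "y \<in> L" for y
        using C[OF that] by (simp add: M_def)
    qed (use that lattice_mult_q near \<rho> in \<open>auto simp: D_def\<close>)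
  qed (use \<open>0 < D\<close> in \<open>auto simp: M_def\<close>)
qed

text \<open>A single extension \<open>F\<close> serves all orders at once, which the series of
  q-derivatives requires.\<close>

lemma extends_iter_deriv:
  assumes "extends S g" "open S" "convex S" "0 \<in> S"
  obtains F where "F holomorphic_on S" "\<And>e. iter_deriv e F holomorphic_on S"
    "\<And>e x. x \<in> L \<inter> S \<Longrightarrow> iter_deriv e g x = iter_deriv e F x"
proof -
  obtain F where F: "F holomorphic_on S" "\<And>x. x \<in> L \<inter> S \<Longrightarrow> g x = F x"
    using assms unfolding extends_def by blast
  have closed: "of_real q * x \<in> S" if "x \<in> S" for x
    using convex_mult_q assms that by blast
  have "iter_deriv e g x = iter_deriv e F x" if "x \<in> L \<inter> S" for e x
    by (rule iter_deriv_cong[where T = "L \<inter> S"])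
      (use that F closed lattice_mult_q lattice_nonzero in auto)
  moreover have "iter_deriv e F holomorphic_on S" for e
    using F(1) assms closed by (intro holomorphic_on_iter_deriv)
  ultimately show ?thesis using that F(1) by blast
qed

lemma extends_iter_derivI:
  assumes "extends S g" "open S" "convex S" "0 \<in> S"
  shows "extends S (iter_deriv e g)"
  by (rule extends_iter_deriv[OF assms]) (auto simp: extends_def)

lemma nice_iter_deriv:
  assumes "nice g"
  shows "nice (iter_deriv e g)"
proof -
  have "\<exists>C. \<forall>x\<in>L. norm x ^ N * norm (iter_deriv e g x) \<le> C" for N
    by (rule nice_iter_deriv_bound[OF assms, of N]) blast
  moreover obtain r where "r > 0" "extends (ball 0 r) g"
    using assms nice_def by blast
  ultimately show ?thesis
    unfolding nice_def rapid_def using extends_iter_derivI[of "ball 0 r" g e] by auto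
qed

section \<open>Series of q-derivatives\<close>

text \<open>The shift by \<open>m\<close> is there for the q-derivatives of the series itself; it
  only changes the constant.\<close>

lemma summable_qop:
  assumes "nice g" "superexp a" "x \<in> L"
  shows "summable (\<lambda>e. norm (a e * iter_deriv (e + m) g x))"
proof -
  obtain M D where MD: "0 < D" "\<And>e x. x \<in> L \<Longrightarrow> norm x ^ 0 * norm (iter_deriv e g x) \<le> M * D ^ e"
    using nice_iter_deriv_bound[OF assms(1), of 0] by metis
  show ?thesis
  proof (rule superexp_summable[OF assms(2) MD(1)])
    show "norm (iter_deriv (e + m) g x) \<le> (M * D ^ m) * D ^ e" for e
      using MD(2)[OF assms(3), of "e + m"] by (simp add: power_add mult_ac)
  qed
qed

text \<open>At a lattice point a q-derivative is a finite difference quotient, so differentiating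
  term by term needs only convergence at the two points \<open>x\<close> and
  \<open>q * x\<close>.\<close>

lemma iter_deriv_qop:
  assumes "nice g" "superexp a" "x \<in> L"
  shows "iter_deriv m (qop a g) x = (\<Sum>e. a e * iter_deriv (e + m) g x)"
  using assms(3)
proof (induction m arbitrary: x)
  case (Suc m)
  have x: "x \<noteq> 0" "of_real q * x \<in> L" using Suc.prems lattice_nonzero lattice_mult_q by auto
  have s: "summable (\<lambda>e. a e * iter_deriv (e + m) g y)" if "y \<in> L" for y
    using summable_norm_cancel[OF summable_qop[OF assms(1,2) that]] .
  have "iter_deriv (Suc m) (qop a g) x =
      ((\<Sum>e. a e * iter_deriv (e + m) g x) - (\<Sum>e. a e * iter_deriv (e + m) g (of_real q * x)))
        / (of_real (1 - q) * x)"
    using x Suc by (simp add: qderiv_nonzero)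
  also have "\<dots> = (\<Sum>e. (a e * iter_deriv (e + m) g x - a e * iter_deriv (e + m) g (of_real q * x))
        / (of_real (1 - q) * x))"
    by (subst suminf_divide[OF summable_diff[OF s[OF Suc.prems] s[OF x(2)]]])
      (simp only: suminf_diff[OF s[OF Suc.prems] s[OF x(2)]])
  also have "\<dots> = (\<Sum>e. a e * iter_deriv (e + Suc m) g x)"
    using x by (simp add: qderiv_nonzero right_diff_distrib)
  finally show ?case .
qed (simp add: qop_def)

text \<open>The series formed with the extension of \<open>g\<close> converges locally uniformly on
  all of \<open>S\<close>, so no part of the domain is lost. Applied to strips, this is the source
  of the left ideal property.\<close>

lemma extends_qop:
  assumes g: "extends S g" and S: "open S" "convex S" "0 \<in> S" and a: "superexp a"
  shows "extends S (qop a g)"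
proof -
  obtain F where F: "F holomorphic_on S" "\<And>e. iter_deriv e F holomorphic_on S"
    "\<And>e x. x \<in> L \<inter> S \<Longrightarrow> iter_deriv e g x = iter_deriv e F x"
    using extends_iter_deriv[OF g S] by blast
  have closed: "of_real q * x \<in> S" if "x \<in> S" for x
    using convex_mult_q S that by blast
  have "(\<lambda>z. \<Sum>e. a e * iter_deriv e F z) holomorphic_on S"
  proof (rule holomorphic_uniform_sequence[OF S(1)])
    show "(\<lambda>z. \<Sum>e<n. a e * iter_deriv e F z) holomorphic_on S" for n
      by (intro holomorphic_on_sum holomorphic_on_mult holomorphic_on_const F(2))
    fix z assume "z \<in> S"
    then obtain d where d: "d > 0" "cball z d \<subseteq> S" using S open_contains_cball by metis
    obtain \<rho> where \<rho>: "\<rho> > 0" "cball 0 \<rho> \<subseteq> S" using S open_contains_cball by metis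
    \<comment> \<open>A bound near \<open>z\<close> involves the points \<open>q ^ k * z\<close>,
      hence a compact set stable under multiplication by \<open>q\<close>. The hull of a disk at
      \<open>z\<close> and a disk at 0 is one, and convexity keeps it in \<open>S\<close>.\<close>
    define K where "K = convex hull (cball z d \<union> cball 0 \<rho>)"
    have "compact K" unfolding K_def by (intro compact_convex_hull compact_Un compact_cball)
    have "convex K" unfolding K_def by simp
    have "K \<subseteq> S" unfolding K_def by (rule hull_minimal) (use d \<rho> S in auto)
    have "cball z d \<union> cball 0 \<rho> \<subseteq> K" unfolding K_def by (rule hull_subset)
    then have K: "cball z d \<subseteq> K" "cball 0 \<rho> \<subseteq> K" by simp_all
    have K_closed: "of_real q * x \<in> K" if "x \<in> K" for x
      by (rule convex_mult_q[OF \<open>convex K\<close> _ that]) (use K(2) \<rho>(1) in auto)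
    have "compact (F ` K)"
      using F(1) \<open>compact K\<close> \<open>K \<subseteq> S\<close> by (intro compact_continuous_image holomorphic_on_imp_continuous_on)
        (auto intro: holomorphic_on_subset)
    then obtain M where M: "\<And>w. w \<in> K \<Longrightarrow> norm (F w) \<le> M"
      by (meson bounded_iff compact_imp_bounded imageI)
    define D where "D = 2 / ((1 - q) * \<rho>)"
    have "0 < D" using \<rho> q_less_1 by (simp add: D_def)
    have bound: "norm (iter_deriv e F w) \<le> M * D ^ e" if "w \<in> K" for e w
    proof -
      have "norm w ^ 0 * norm (iter_deriv e F w) \<le> M * D ^ e"
      \<comment> \<open>With \<open>N = 0\<close> the factor \<open>1 + 1 / q ^ N\<close> equals 2,
        so the rates near 0 and away from 0 are the same \<open>D\<close>.\<close>
      proof (rule iter_deriv_bound[where S = K and \<rho> = \<rho>])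
        show "norm x ^ 0 * norm (iter_deriv n F x) \<le> M * D ^ n" if "x \<in> K" "norm x < \<rho>" for n x
          using iter_deriv_bound_cball[OF F(1) S(1) \<rho>(2,1) closed M[OF subsetD[OF K(2)]], of x n] that
          by (auto simp: D_def)
      qed (use that M K_closed \<rho> in \<open>auto simp: D_def\<close>)
      then show ?thesis by simp
    qed
    have "uniform_limit (cball z d) (\<lambda>n w. \<Sum>e<n. a e * iter_deriv e F w)
        (\<lambda>w. \<Sum>e. a e * iter_deriv e F w) sequentially"
    proof (rule Weierstrass_m_test)
      show "summable (\<lambda>e. M * (norm (a e) * D ^ e))"
        using a \<open>0 < D\<close> unfolding superexp_def by (intro summable_mult) blast
      show "norm (a e * iter_deriv e F w) \<le> M * (norm (a e) * D ^ e)" if "w \<in> cball z d" for e w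
        using mult_left_mono[OF bound, of w "norm (a e)" e] that K(1) by (auto simp: norm_mult mult_ac)
    qed
    then show "\<exists>d>0. cball z d \<subseteq> S \<and> uniform_limit (cball z d)
        (\<lambda>n w. \<Sum>e<n. a e * iter_deriv e F w) (\<lambda>w. \<Sum>e. a e * iter_deriv e F w) sequentially"
      using d by blast
  qed
  then show ?thesis unfolding extends_def qop_def using F(3) by force
qed

lemma nice_qop:
  assumes "nice g" "superexp a"
  shows "nice (qop a g)"
proof -
  have "\<exists>C. \<forall>x\<in>L. norm x ^ N * norm (qop a g x) \<le> C" for N
  proof -
    obtain M D where MD: "0 < D" "\<And>e x. x \<in> L \<Longrightarrow> norm x ^ N * norm (iter_deriv e g x) \<le> M * D ^ e"
      using nice_iter_deriv_bound[OF assms(1), of N] by metis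
    have s: "summable (\<lambda>e. M * (norm (a e) * D ^ e))"
      using assms(2) MD(1) unfolding superexp_def by (intro summable_mult) blast
    have "norm x ^ N * norm (qop a g x) \<le> (\<Sum>e. M * (norm (a e) * D ^ e))" if "x \<in> L" for x
    proof -
      have sn: "summable (\<lambda>e. norm (a e * iter_deriv e g x))"
        using summable_qop[OF assms that, of 0] by simp
      then have "norm x ^ N * norm (qop a g x) \<le> norm x ^ N * (\<Sum>e. norm (a e * iter_deriv e g x))"
        unfolding qop_def by (intro mult_left_mono summable_norm) auto
      also have "\<dots> = (\<Sum>e. norm x ^ N * norm (a e * iter_deriv e g x))"
        using sn by (rule suminf_mult[symmetric])
      also have "\<dots> \<le> (\<Sum>e. M * (norm (a e) * D ^ e))"
      proof (rule suminf_le)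
        show "norm x ^ N * norm (a e * iter_deriv e g x) \<le> M * (norm (a e) * D ^ e)" for e
          using mult_left_mono[OF MD(2)[OF that], of "norm (a e)" e] by (simp add: norm_mult mult_ac)
      qed (use s sn summable_mult in auto)
      finally show ?thesis .
    qed
    then show ?thesis by blast
  qed
  moreover obtain r where "r > 0" "extends (ball 0 r) g"
    using assms nice_def by blast
  ultimately show ?thesis
    unfolding nice_def rapid_def using extends_qop[of "ball 0 r" g a] assms(2) by auto
qed

section \<open>The q-integral\<close>

abbreviation index :: "(int \<times> real) set" where "index \<equiv> UNIV \<times> {1, -1}"

text \<open>A summable majorant decaying in both directions of the lattice: it dominates the modulus
  of a point for nonnegative \<open>k\<close> and its reciprocal for negative \<open>k\<close>; the
  maximum covers both cases.\<close>

definition weight :: "int \<times> real \<Rightarrow> real" where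
  "weight p = max \<gamma> (1 / \<gamma>) * q ^ nat \<bar>fst p\<bar>"

lemma weight_nonneg: "0 \<le> weight p"
  using \<gamma>_pos q_pos by (simp add: weight_def max_def)

lemma weight_summable: "weight summable_on index"
proof -
  have geo: "(\<lambda>n::nat. q ^ n) summable_on UNIV"
    using q_pos q_less_1 by (subst summable_on_UNIV_nonneg_real_iff) (auto intro: summable_geometric)
  then have geo1: "(\<lambda>n::nat. q ^ Suc n) summable_on UNIV"
    by (simp add: summable_on_cmult_right)
  have "(\<lambda>k::int. q ^ nat \<bar>k\<bar>) summable_on range int"
    using geo by (subst summable_on_reindex) (auto simp: o_def)
  moreover have "(\<lambda>k::int. q ^ nat \<bar>k\<bar>) summable_on range (\<lambda>n. - int (Suc n))"
    using geo1 by (subst summable_on_reindex) (auto simp: o_def inj_def nat_add_distrib)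
  moreover have "range int \<inter> range (\<lambda>n. - int (Suc n)) = {}" by auto
  ultimately have "(\<lambda>k::int. q ^ nat \<bar>k\<bar>) summable_on (range int \<union> range (\<lambda>n. - int (Suc n)))"
    by (rule summable_on_Un_disjoint)
  moreover have "range int \<union> range (\<lambda>n. - int (Suc n)) = UNIV"
  proof (rule UNIV_eq_I[symmetric])
    fix k :: int show "k \<in> range int \<union> range (\<lambda>n. - int (Suc n))"
      by (cases k rule: int_cases) auto
  qed
  ultimately have "(\<lambda>k::int. q ^ nat \<bar>k\<bar>) summable_on UNIV" by simp
  then have "(\<lambda>k. weight (k, \<epsilon>)) summable_on UNIV" for \<epsilon> :: real
    unfolding weight_def fst_conv by (rule summable_on_cmult_right)
  then have "weight summable_on range (\<lambda>k. (k, \<epsilon>))" for \<epsilon>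
    by (subst summable_on_reindex) (auto simp: o_def inj_def)
  then have "weight summable_on (range (\<lambda>k. (k, 1)) \<union> range (\<lambda>k. (k, -1)))"
    by (intro summable_on_Un_disjoint) auto
  moreover have "index = range (\<lambda>k. (k, 1)) \<union> range (\<lambda>k. (k, -1))" by auto
  ultimately show ?thesis by simp
qed

text \<open>Write \<open>t\<close> for the modulus of the point. Towards 0 the measure factor
  \<open>t\<close> is itself summable and boundedness of the function suffices; towards infinity the
  bound on \<open>t ^ 2\<close> times the function leaves \<open>C / t\<close>.\<close>

lemma qint_term_bound:
  assumes "\<And>x. x \<in> L \<Longrightarrow> norm (\<phi> x) \<le> C" "\<And>x. x \<in> L \<Longrightarrow> norm x ^ 2 * norm (\<phi> x) \<le> C"
    and "p \<in> index"
  shows "norm (qint_term q \<gamma> \<phi> p) \<le> C * weight p"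
proof -
  obtain k \<epsilon> where p: "p = (k, \<epsilon>)" "\<epsilon> \<in> {1, -1}" using assms(3) by auto
  define x where "x = complex_of_real (qpoint q \<gamma> k \<epsilon>)"
  define t where "t = q powi k * \<gamma>"
  have x: "x \<in> L" "norm x = t" unfolding x_def t_def using p qpoint_in_lattice norm_qpoint by auto
  have "t > 0" unfolding t_def using q_pos \<gamma>_pos by simp
  have "0 \<le> C" using assms(1)[OF x(1)] norm_ge_zero order_trans by blast
  have n: "norm (qint_term q \<gamma> \<phi> p) = t * norm (\<phi> x)"
    using \<open>t > 0\<close> by (simp add: qint_term_def p x_def norm_mult t_def flip: of_real_mult of_real_power_int)
  show ?thesis
  proof (cases "k \<ge> 0")
    case True
    then have "t = q ^ nat \<bar>k\<bar> * \<gamma>" by (simp add: t_def power_int_def)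
    also have "\<dots> \<le> weight p"
      unfolding weight_def p fst_conv mult.commute[of "q ^ _"] using q_pos by (intro mult_right_mono) auto
    finally have "t * norm (\<phi> x) \<le> weight p * C"
      using assms(1)[OF x(1)] weight_nonneg by (intro mult_mono) auto
    then show ?thesis using n by (simp add: mult.commute)
  next
    case False
    then have "1 / t = q ^ nat \<bar>k\<bar> * (1 / \<gamma>)"
      using q_pos \<gamma>_pos by (simp add: t_def power_int_def field_simps)
    also have "\<dots> \<le> weight p"
      unfolding weight_def p fst_conv mult.commute[of "q ^ _"] using q_pos by (intro mult_right_mono) auto
    finally have "1 / t * (t ^ 2 * norm (\<phi> x)) \<le> weight p * C"
      using assms(2)[OF x(1)] weight_nonneg x(2) by (intro mult_mono) auto
    then show ?thesis using n \<open>t > 0\<close> by (simp add: mult.commute power2_eq_square)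
  qed
qed

section \<open>Rapid decay and integrability\<close>

lemma rapid_mult_power:
  assumes "rapid f"
  shows "rapid (\<lambda>x. f x * x ^ e)"
  unfolding rapid_def
proof
  fix N
  show "\<exists>C. \<forall>x\<in>L. norm x ^ N * norm (f x * x ^ e) \<le> C"
    using assms[unfolded rapid_def, rule_format, of "N + e"]
    by (simp add: norm_mult norm_power power_add mult_ac)
qed

lemma rapid_qintegrable:
  assumes "rapid \<phi>"
  shows "qintegrable q \<gamma> \<phi>"
proof -
  obtain C0 where C0: "\<And>x. x \<in> L \<Longrightarrow> norm x ^ 0 * norm (\<phi> x) \<le> C0"
    using assms unfolding rapid_def by blast
  obtain C2 where C2: "\<And>x. x \<in> L \<Longrightarrow> norm x ^ 2 * norm (\<phi> x) \<le> C2"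
    using assms unfolding rapid_def by blast
  show ?thesis
    unfolding qintegrable_def
  proof (rule Infinite_Sum.abs_summable_on_comparison_test')
    show "(\<lambda>p. max C0 C2 * weight p) summable_on index"
      by (intro summable_on_cmult_right weight_summable)
    show "norm (qint_term q \<gamma> \<phi> p) \<le> max C0 C2 * weight p" if "p \<in> index" for p
      using C0 C2 that by (intro qint_term_bound) (auto simp: le_max_iff_disj)
  qed
qed

lemma rapid_I_infty: "rapid f \<Longrightarrow> f \<in> funs_on L \<Longrightarrow> f \<in> I_infty q \<gamma>"
  using rapid_mult_power rapid_qintegrable by (simp add: I_infty_def)

text \<open>Each term of an absolutely convergent sum is bounded by the whole sum. The measure
  contributes one factor \<open>norm x\<close>, so this yields only positive exponents; exponent 0
  follows from the extension near the origin and from exponent 1 elsewhere.\<close>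

lemma I_infty_rapid:
  assumes f: "f \<in> I_infty q \<gamma>" and ext: "extends (ball 0 r) f" "r > 0"
  shows "rapid f"
proof -
  have Suc: "\<exists>C. \<forall>x\<in>L. norm x ^ Suc n * norm (f x) \<le> C" for n
  proof -
    define h where "h = qint_term q \<gamma> (\<lambda>x. f x * x ^ n)"
    have s: "(\<lambda>p. norm (h p)) summable_on index"
      using f unfolding I_infty_def qintegrable_def h_def by blast
    have "norm x ^ Suc n * norm (f x) \<le> infsum (\<lambda>p. norm (h p)) index" if "x \<in> L" for x
    proof -
      obtain k \<epsilon> where x: "x = of_real (qpoint q \<gamma> k \<epsilon>)" "\<epsilon> \<in> {1, -1}"
        using \<open>x \<in> L\<close> by (rule lattice_cases)
      have "norm (h (k, \<epsilon>)) \<le> infsum (\<lambda>p. norm (h p)) index"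
        using finite_sum_le_infsum[OF s, of "{(k, \<epsilon>)}"] x by auto
      moreover have "norm (h (k, \<epsilon>)) = norm x ^ Suc n * norm (f x)"
        using norm_qpoint[OF x(2), of k] q_pos \<gamma>_pos
        by (simp add: h_def qint_term_def x(1)[symmetric] norm_mult norm_power norm_power_int)
      ultimately show ?thesis by simp
    qed
    then show ?thesis by blast
  qed
  obtain F where F: "F holomorphic_on ball 0 r" "\<And>x. x \<in> L \<inter> ball 0 r \<Longrightarrow> f x = F x"
    using ext unfolding extends_def by blast
  have sub: "cball 0 (r / 2) \<subseteq> ball (0::complex) r" using ext(2) by auto
  have "compact (F ` cball 0 (r / 2))"
    using F(1) sub by (intro compact_continuous_image holomorphic_on_imp_continuous_on)
      (auto intro: holomorphic_on_subset)
  then obtain M where M: "\<And>z. z \<in> cball 0 (r / 2) \<Longrightarrow> norm (F z) \<le> M"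
    by (meson bounded_iff compact_imp_bounded imageI)
  obtain C where C: "\<And>x. x \<in> L \<Longrightarrow> norm x ^ Suc 0 * norm (f x) \<le> C" using Suc by blast
  have "norm (f x) \<le> max M (C / (r / 2))" if "x \<in> L" for x
  proof (cases "norm x \<le> r / 2")
    case True
    then have "f x = F x" using F(2)[of x] that ext(2) by simp
    then show ?thesis using M[of x] True by (simp add: le_max_iff_disj)
  next
    case False
    then have "(r / 2) * norm (f x) \<le> norm x * norm (f x)" by (intro mult_right_mono) auto
    then have "norm (f x) \<le> C / (r / 2)" using C[OF that] ext(2) by (simp add: field_simps)
    then show ?thesis by simp
  qed
  then have zero: "\<exists>C. \<forall>x\<in>L. norm x ^ 0 * norm (f x) \<le> C" by (metis mult_1 power_0)
  show ?thesis
    unfolding rapid_def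
  proof
    fix N show "\<exists>C. \<forall>x\<in>L. norm x ^ N * norm (f x) \<le> C" by (cases N) (use Suc zero in auto)
  qed
qed

section \<open>Linearity, scaling and termwise integration\<close>

lemma qint_term_cong:
  assumes "\<And>x. x \<in> L \<Longrightarrow> f x = g x" "p \<in> index"
  shows "qint_term q \<gamma> f p = qint_term q \<gamma> g p"
  using assms qpoint_in_lattice by (auto simp: qint_term_def)

lemma qintegral_cong:
  assumes "\<And>x. x \<in> L \<Longrightarrow> f x = g x"
  shows "qintegral q \<gamma> f = qintegral q \<gamma> g"
  unfolding qintegral_def using qint_term_cong[OF assms] by (simp cong: infsum_cong)

lemma qint_term_summable:
  assumes "qintegrable q \<gamma> f"
  shows "qint_term q \<gamma> f summable_on index"
  using assms unfolding qintegrable_def by (rule abs_summable_summable)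

lemma qintegral_add:
  assumes "qintegrable q \<gamma> f" "qintegrable q \<gamma> g"
  shows "qintegral q \<gamma> (\<lambda>x. f x + g x) = qintegral q \<gamma> f + qintegral q \<gamma> g"
proof -
  have "qint_term q \<gamma> (\<lambda>x. f x + g x) = (\<lambda>p. qint_term q \<gamma> f p + qint_term q \<gamma> g p)"
    by (auto simp: qint_term_def distrib_left)
  then show ?thesis
    using assms by (simp add: qintegral_def infsum_add qint_term_summable distrib_left)
qed

lemma qintegral_cmult: "qintegral q \<gamma> (\<lambda>x. c * f x) = c * qintegral q \<gamma> f"
proof -
  have "qint_term q \<gamma> (\<lambda>x. c * f x) = (\<lambda>p. c * qint_term q \<gamma> f p)"
    by (auto simp: qint_term_def)
  then show ?thesis
    by (simp add: qintegral_def infsum_cmult_right')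
qed

text \<open>Multiplication by \<open>q\<close> shifts the index \<open>k\<close> by one, and the
  measure changes by the factor \<open>q\<close>.\<close>

lemma qintegral_scale: "qintegral q \<gamma> (\<lambda>x. f (of_real q * x)) = qintegral q \<gamma> f / of_real q"
proof -
  define s where "s = (\<lambda>(k::int, \<epsilon>::real). (k + 1, \<epsilon>))"
  have s: "bij_betw s index index"
    by (rule bij_betwI[where g = "\<lambda>(k, \<epsilon>). (k - 1, \<epsilon>)"]) (auto simp: s_def)
  have "qint_term q \<gamma> (\<lambda>x. f (of_real q * x)) = (\<lambda>p. (1 / of_real q) * qint_term q \<gamma> f (s p))"
    using q_pos by (auto simp: s_def qint_term_def of_real_qpoint_Suc power_int_add_1)
  then have "qintegral q \<gamma> (\<lambda>x. f (of_real q * x))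
      = of_real (1 - q) * ((1 / of_real q) * infsum (\<lambda>p. qint_term q \<gamma> f (s p)) index)"
    by (simp only: qintegral_def infsum_cmult_right')
  also have "infsum (\<lambda>p. qint_term q \<gamma> f (s p)) index = infsum (qint_term q \<gamma> f) index"
    using s by (rule infsum_reindex_bij_betw)
  finally show ?thesis by (simp add: qintegral_def)
qed

text \<open>Sum and integral may be exchanged because the double family is dominated by a factor
  summable in \<open>e\<close> times \<open>weight\<close>.\<close>

lemma qintegral_qop:
  assumes g: "nice g" and a: "superexp a"
  shows "qintegral q \<gamma> (\<lambda>x. qop a g x * x ^ n)
    = (\<Sum>e. a e * qintegral q \<gamma> (\<lambda>x. iter_deriv e g x * x ^ n))"
proof -
  obtain M1 D1 where 1: "0 \<le> M1" "0 < D1"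
    "\<And>e x. x \<in> L \<Longrightarrow> norm x ^ n * norm (iter_deriv e g x) \<le> M1 * D1 ^ e"
    using nice_iter_deriv_bound[OF g, of n] by metis
  \<comment> \<open>Two additional powers provide the decay at infinity that
    \<open>qint_term_bound\<close> asks for.\<close>
  obtain M2 D2 where 2: "0 \<le> M2" "0 < D2"
    "\<And>e x. x \<in> L \<Longrightarrow> norm x ^ (n + 2) * norm (iter_deriv e g x) \<le> M2 * D2 ^ e"
    using nice_iter_deriv_bound[OF g, of "n + 2"] by metis
  define M D where "M = max M1 M2" and "D = max D1 D2"
  have MD: "M1 * D1 ^ e \<le> M * D ^ e" "M2 * D2 ^ e \<le> M * D ^ e" for e
    using 1(1,2) 2(1,2) by (auto simp: M_def D_def intro!: mult_mono power_mono)
  define t where "t p e = qint_term q \<gamma> (\<lambda>x. iter_deriv e g x * x ^ n) p" for p e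
  have t_bound: "norm (t p e) \<le> (M * D ^ e) * weight p" if "p \<in> index" for p e
    unfolding t_def
  proof (rule qint_term_bound[OF _ _ that])
    fix x assume x: "x \<in> L"
    show "norm (iter_deriv e g x * x ^ n) \<le> M * D ^ e"
      using 1(3)[OF x, of e] MD(1)[of e] by (simp add: norm_mult norm_power mult.commute)
    show "norm x ^ 2 * norm (iter_deriv e g x * x ^ n) \<le> M * D ^ e"
      using 2(3)[OF x, of e] MD(2)[of e] by (simp add: norm_mult norm_power mult_ac power_add power2_eq_square)
  qed
  define c where "c e = norm (a e) * (M * D ^ e)" for e
  have "0 < D" "0 \<le> M" using 1 2 by (auto simp: M_def D_def)
  then have "0 \<le> c e" for e by (simp add: c_def)
  have "summable (\<lambda>e. norm (a e) * D ^ e)" using a \<open>0 < D\<close> by (simp add: superexp_def)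
  then have "summable c" unfolding c_def by (simp add: summable_mult mult.left_commute)
  then have c_summable: "c summable_on UNIV"
    using \<open>\<And>e. 0 \<le> c e\<close> by (subst summable_on_UNIV_nonneg_real_iff) auto
  have joint: "(\<lambda>(e, p). a e * t p e) summable_on UNIV \<times> index"
  proof (rule summable_on_product_bound[OF c_summable _ weight_summable weight_nonneg])
    show "norm (a e * t p e) \<le> c e * weight p" if "p \<in> index" for p e
      using mult_left_mono[OF t_bound[OF that], of "norm (a e)" e] by (simp add: c_def norm_mult mult_ac)
  qed fact
  have qop_term: "qint_term q \<gamma> (\<lambda>x. qop a g x * x ^ n) p = infsum (\<lambda>e. a e * t p e) UNIV"
    if p: "p \<in> index" for p
  proof -
    obtain k \<epsilon> where ke: "p = (k, \<epsilon>)" "\<epsilon> \<in> {1, -1}" using p by auto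
    define x where "x = complex_of_real (qpoint q \<gamma> k \<epsilon>)"
    have x: "x \<in> L" unfolding x_def using ke qpoint_in_lattice by auto
    define v where "v = complex_of_real (q powi k * \<gamma>) * x ^ n"
    have v: "a e * t p e = a e * iter_deriv e g x * v" for e
      by (simp add: t_def qint_term_def ke x_def v_def)
    have sn: "summable (\<lambda>e. norm (a e * iter_deriv e g x))"
      using summable_qop[OF g a x, of 0] by simp
    have "(\<lambda>e. a e * t p e) sums (qop a g x * v)"
      unfolding v qop_def using summable_norm_cancel[OF sn] by (intro sums_mult2 summable_sums)
    moreover have "summable (\<lambda>e. norm (a e * t p e))"
      using summable_mult2[OF sn, of "norm v"] by (simp add: v norm_mult)
    ultimately have "infsum (\<lambda>e. a e * t p e) UNIV = qop a g x * v"
      by (intro infsumI norm_summable_imp_has_sum)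
    then show ?thesis by (simp add: qint_term_def ke x_def v_def mult_ac)
  qed
  have outer: "(\<lambda>e. a e * infsum (\<lambda>p. t p e) index) summable_on UNIV"
    using summable_on_Sigma_banach[OF joint] by (simp add: infsum_cmult_right')
  have "infsum (qint_term q \<gamma> (\<lambda>x. qop a g x * x ^ n)) index
      = infsum (\<lambda>p. infsum (\<lambda>e. a e * t p e) UNIV) index"
    by (rule infsum_cong) (rule qop_term)
  also have "\<dots> = infsum (\<lambda>e. infsum (\<lambda>p. a e * t p e) index) UNIV"
    by (rule infsum_swap_banach[OF joint, symmetric])
  also have "\<dots> = infsum (\<lambda>e. a e * infsum (\<lambda>p. t p e) index) UNIV"
    by (simp add: infsum_cmult_right')
  also have "\<dots> = (\<Sum>e. a e * infsum (\<lambda>p. t p e) index)"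
    using outer by (rule infsum_nat_suminf)
  finally have sum_eq: "infsum (qint_term q \<gamma> (\<lambda>x. qop a g x * x ^ n)) index
      = (\<Sum>e. a e * infsum (\<lambda>p. t p e) index)" .
  have "(\<Sum>e. a e * qintegral q \<gamma> (\<lambda>x. iter_deriv e g x * x ^ n))
      = (\<Sum>e. of_real (1 - q) * (a e * infsum (\<lambda>p. t p e) index))"
    by (simp add: qintegral_def t_def mult.left_commute)
  also have "\<dots> = of_real (1 - q) * (\<Sum>e. a e * infsum (\<lambda>p. t p e) index)"
    using infsum_nat_suminf(1)[OF outer] by (intro suminf_mult) (rule sums_summable)
  finally show ?thesis by (simp add: qintegral_def sum_eq)
qed

lemma rapid_add:
  assumes "rapid f" "rapid g"
  shows "rapid (\<lambda>x. f x + g x)"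
  unfolding rapid_def
proof
  fix N
  obtain C1 C2 where C: "\<And>x. x \<in> L \<Longrightarrow> norm x ^ N * norm (f x) \<le> C1"
    "\<And>x. x \<in> L \<Longrightarrow> norm x ^ N * norm (g x) \<le> C2"
    using assms unfolding rapid_def by metis
  have "norm x ^ N * norm (f x + g x) \<le> C1 + C2" if "x \<in> L" for x
  proof -
    have "norm x ^ N * norm (f x + g x) \<le> norm x ^ N * (norm (f x) + norm (g x))"
      by (intro mult_left_mono norm_triangle_ineq) auto
    also have "\<dots> \<le> C1 + C2"
      unfolding distrib_left by (intro add_mono C that)
    finally show ?thesis .
  qed
  then show "\<exists>C. \<forall>x\<in>L. norm x ^ N * norm (f x + g x) \<le> C" by blast
qed

lemma rapid_cmult:
  assumes "rapid f"
  shows "rapid (\<lambda>x. c * f x)"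
  unfolding rapid_def
proof
  fix N
  obtain C where C: "\<And>x. x \<in> L \<Longrightarrow> norm x ^ N * norm (f x) \<le> C"
    using assms unfolding rapid_def by metis
  have "norm x ^ N * norm (c * f x) \<le> norm c * C" if "x \<in> L" for x
    using mult_left_mono[OF C[OF that], of "norm c"] by (simp add: norm_mult mult_ac)
  then show "\<exists>C. \<forall>x\<in>L. norm x ^ N * norm (c * f x) \<le> C" by blast
qed

lemma rapid_scale:
  assumes "rapid f"
  shows "rapid (\<lambda>x. f (of_real q * x))"
  unfolding rapid_def
proof
  fix N
  obtain C where C: "\<And>x. x \<in> L \<Longrightarrow> norm x ^ N * norm (f x) \<le> C"
    using assms unfolding rapid_def by metis
  have "norm x ^ N * norm (f (of_real q * x)) \<le> C / q ^ N" if "x \<in> L" for x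
    using C[OF lattice_mult_q[OF that]] q_pos by (simp add: norm_mult power_mult_distrib field_simps)
  then show "\<exists>C. \<forall>x\<in>L. norm x ^ N * norm (f (of_real q * x)) \<le> C" by blast
qed

section \<open>Moments\<close>

lemma qpoint_tendsto_0: "(\<lambda>n. complex_of_real (qpoint q \<gamma> (int n + 1) \<epsilon>)) \<longlonglongrightarrow> 0"
proof -
  have "(\<lambda>n. complex_of_real (\<epsilon> * (q ^ Suc n) * \<gamma>)) \<longlonglongrightarrow> complex_of_real (\<epsilon> * 0 * \<gamma>)"
    using q_pos q_less_1 by (intro tendsto_intros LIMSEQ_Suc LIMSEQ_realpow_zero) auto
  moreover have "qpoint q \<gamma> (int n + 1) \<epsilon> = \<epsilon> * (q ^ Suc n) * \<gamma>" for n
    using q_pos by (simp add: qpoint_def power_int_add_1)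
  ultimately show ?thesis by simp
qed

text \<open>The integral telescopes; the boundary terms at the origin cancel between the two
  half-lines because the holomorphic extension is continuous there.\<close>

lemma qintegral_qderiv:
  assumes h: "nice h"
  shows "qintegral q \<gamma> (qderiv q h) = 0"
proof -
  define x where "x k \<epsilon> = complex_of_real (qpoint q \<gamma> k \<epsilon>)" for k \<epsilon>
  have xL: "x k \<epsilon> \<in> L" if "\<epsilon> \<in> {1, -1}" for k \<epsilon> unfolding x_def using that by (rule qpoint_in_lattice)
  obtain r F where r: "r > 0" and F: "F holomorphic_on ball 0 r" "\<And>y. y \<in> L \<inter> ball 0 r \<Longrightarrow> h y = F y"
    using h unfolding nice_def extends_def by blast
  obtain C where C: "\<And>y. y \<in> L \<Longrightarrow> norm y ^ 1 * norm (h y) \<le> C"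
    using h unfolding nice_def rapid_def by blast
  have at_0: "(\<lambda>n. h (x (int n + 1) \<epsilon>)) \<longlonglongrightarrow> F 0" if \<epsilon>: "\<epsilon> \<in> {1, -1}" for \<epsilon>
  proof -
    have lim: "(\<lambda>n. x (int n + 1) \<epsilon>) \<longlonglongrightarrow> 0" unfolding x_def by (rule qpoint_tendsto_0)
    have "isCont F 0"
      using holomorphic_on_imp_continuous_on[OF F(1)] r by (simp add: continuous_on_eq_continuous_at)
    then have F_lim: "(\<lambda>n. F (x (int n + 1) \<epsilon>)) \<longlonglongrightarrow> F 0"
      using lim by (rule isCont_tendsto_compose)
    have "eventually (\<lambda>n. x (int n + 1) \<epsilon> \<in> ball 0 r) sequentially"
      using lim r by (intro topological_tendstoD) auto
    then have "eventually (\<lambda>n. F (x (int n + 1) \<epsilon>) = h (x (int n + 1) \<epsilon>)) sequentially"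
      by eventually_elim (use F(2) xL[OF \<epsilon>] in auto)
    then show ?thesis using F_lim by (rule Lim_transform_eventually[rotated])
  qed
  have at_inf: "(\<lambda>n. h (x (- int n) \<epsilon>)) \<longlonglongrightarrow> 0" if \<epsilon>: "\<epsilon> \<in> {1, -1}" for \<epsilon>
  proof (rule Lim_null_comparison)
    show "eventually (\<lambda>n. norm (h (x (- int n) \<epsilon>)) \<le> C / \<gamma> * q ^ n) sequentially"
    proof (intro always_eventually allI)
      fix n
      have "norm (x (- int n) \<epsilon>) = \<gamma> / q ^ n"
        unfolding x_def norm_qpoint[OF \<epsilon>] using q_pos by (simp add: power_int_minus field_simps)
      then show "norm (h (x (- int n) \<epsilon>)) \<le> C / \<gamma> * q ^ n"
        using C[OF xL[OF \<epsilon>], of "- int n"] q_pos \<gamma>_pos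
        by (simp add: pos_divide_le_eq pos_le_divide_eq mult.commute)
    qed
    show "(\<lambda>n. C / \<gamma> * q ^ n) \<longlonglongrightarrow> 0"
      using q_pos q_less_1 by (intro tendsto_mult_right_zero LIMSEQ_realpow_zero) auto
  qed
  define T where "T = qint_term q \<gamma> (qderiv q h)"
  \<comment> \<open>The measure uses the modulus of the point while the q-derivative divides by the
    point itself; their quotient is the sign \<open>\<epsilon>\<close>. The two half-lines therefore
    enter with opposite signs.\<close>
  have T: "T (k, \<epsilon>) = of_real (\<epsilon> / (1 - q)) * (h (x k \<epsilon>) - h (x (k + 1) \<epsilon>))" if \<epsilon>: "\<epsilon> \<in> {1, -1}" for k \<epsilon>
  proof -
    have "T (k, \<epsilon>) = of_real (q powi k * \<gamma>) * qderiv q h (x k \<epsilon>)"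
      by (simp add: T_def qint_term_def x_def)
    also have "qderiv q h (x k \<epsilon>) = (h (x k \<epsilon>) - h (x (k + 1) \<epsilon>)) / (of_real (1 - q) * x k \<epsilon>)"
      using lattice_nonzero[OF xL[OF \<epsilon>, of k]] unfolding x_def of_real_qpoint_Suc by (simp add: qderiv_nonzero)
    finally have "T (k, \<epsilon>) = (of_real (q powi k * \<gamma>) / (of_real (1 - q) * x k \<epsilon>)) * (h (x k \<epsilon>) - h (x (k + 1) \<epsilon>))"
      by simp
    moreover have "complex_of_real (q powi k * \<gamma>) / (of_real (1 - q) * x k \<epsilon>) = of_real (\<epsilon> / (1 - q))"
      using \<epsilon> q_pos \<gamma>_pos unfolding x_def qpoint_def by (auto simp: minus_divide_right)
    ultimately show ?thesis by (simp only:)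
  qed
  \<comment> \<open>The symmetric boxes exhaust the index set, so the unordered sum is the limit of
    their sums, and these telescope.\<close>
  define B where "B n = {- int n..int n} \<times> {1, - 1::real}" for n :: nat
  have "filterlim B (finite_subsets_at_top index) sequentially"
    unfolding filterlim_finite_subsets_at_top
  proof (intro allI impI)
    fix X :: "(int \<times> real) set" assume X: "finite X \<and> X \<subseteq> index"
    have "eventually (\<lambda>n. \<forall>p\<in>X. nat \<bar>fst p\<bar> \<le> n) sequentially"
      using X by (intro eventually_ball_finite ballI eventually_ge_at_top) auto
    then show "eventually (\<lambda>n. finite (B n) \<and> X \<subseteq> B n \<and> B n \<subseteq> index) sequentially"
    proof eventually_elim
      case (elim n)
      have "p \<in> B n" if "p \<in> X" for p
        using bspec[OF elim that] subsetD[OF conjunct2[OF X] that] by (cases p) (auto simp: B_def)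
      then show ?case by (auto simp: B_def)
    qed
  qed
  moreover have "T summable_on index"
    unfolding T_def using nice_iter_deriv[OF h, of 1]
    by (intro qint_term_summable rapid_qintegrable) (simp add: nice_def)
  ultimately have lim: "(\<lambda>n. sum T (B n)) \<longlonglongrightarrow> infsum T index"
    using infsum_tendsto filterlim_compose by blast
  have "sum T (B n) = of_real (1 / (1 - q)) * ((h (x (- int n) 1) - h (x (int n + 1) 1))
      - (h (x (- int n) (-1)) - h (x (int n + 1) (-1))))" for n
  proof -
    have "sum T (B n) = (\<Sum>k\<in>{- int n..int n}. T (k, 1) + T (k, -1))"
      using sum.cartesian_product[of "\<lambda>k \<epsilon>. T (k, \<epsilon>)" "{1, -1}" "{- int n..int n}"] by (simp add: B_def)
    also have "\<dots> = (\<Sum>k\<in>{- int n..int n}. of_real (1 / (1 - q)) * ((h (x k 1) - h (x (k + 1) 1))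
        - (h (x k (-1)) - h (x (k + 1) (-1)))))"
      by (simp add: T algebra_simps diff_divide_distrib)
    also have "\<dots> = of_real (1 / (1 - q)) * ((\<Sum>k\<in>{- int n..int n}. h (x k 1) - h (x (k + 1) 1))
        - (\<Sum>k\<in>{- int n..int n}. h (x k (-1)) - h (x (k + 1) (-1))))"
      by (simp only: sum_distrib_left[symmetric] sum_subtractf[symmetric])
    finally show ?thesis
      by (simp only: telescope_int[of "\<lambda>k. h (x k 1)"] telescope_int[of "\<lambda>k. h (x k (-1))"])
  qed
  moreover have "(\<lambda>n. of_real (1 / (1 - q)) * ((h (x (- int n) 1) - h (x (int n + 1) 1))
      - (h (x (- int n) (-1)) - h (x (int n + 1) (-1))))) \<longlonglongrightarrow> of_real (1 / (1 - q)) * ((0 - F 0) - (0 - F 0))"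
    by (intro tendsto_intros at_0 at_inf) auto
  ultimately have "(\<lambda>n. sum T (B n)) \<longlonglongrightarrow> 0" by simp
  then have "infsum T index = 0" using lim LIMSEQ_unique by blast
  then show ?thesis by (simp add: qintegral_def T_def)
qed

lemma qmoment_qderiv_0:
  assumes "nice h"
  shows "qmoment q \<gamma> 0 (qderiv q h) = 0"
  using qintegral_qderiv[OF assms] by (simp add: qmoment_def)

text \<open>Integration by parts: the rescaling \<open>x\<close> to \<open>q * x\<close> produces
  the factor \<open>(1 - q powi (- (m + 1))) / (1 - q)\<close>, which is
  \<open>- qnum q (m + 1) / q ^ (m + 1)\<close>. The triangular power of \<open>q\<close> in the
  moments is designed to cancel this denominator.\<close>

lemma qmoment_qderiv_Suc:
  assumes h: "nice h"
  shows "qmoment q \<gamma> (Suc m) (qderiv q h) = - of_real (qnum q (Suc m)) * qmoment q \<gamma> m h"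
proof -
  define \<phi> where "\<phi> x = h x * x ^ m" for x
  define I where "I = qintegral q \<gamma> \<phi>"
  have \<phi>: "rapid \<phi>" unfolding \<phi>_def using h by (intro rapid_mult_power) (simp add: nice_def)
  \<comment> \<open>In \<open>h (q * x) * x ^ m\<close> the power is rewritten through
    \<open>(q * x) ^ m\<close>, at the cost of \<open>1 / q ^ m\<close>; the sign is that of the
    difference.\<close>
  define c where "c = complex_of_real (- 1 / q ^ m)"
  have "qintegral q \<gamma> (\<lambda>x. qderiv q h x * x ^ Suc m)
      = qintegral q \<gamma> (\<lambda>x. (1 / of_real (1 - q)) * (\<phi> x + c * \<phi> (of_real q * x)))"
  proof (rule qintegral_cong)
    fix x assume "x \<in> L"
    then have "x \<noteq> 0" by (rule lattice_nonzero)
    then have "qderiv q h x * x ^ Suc m = (1 / of_real (1 - q)) * (h x * x ^ m - h (of_real q * x) * x ^ m)"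
      by (simp add: qderiv_nonzero flip: left_diff_distrib)
    also have "h x * x ^ m - h (of_real q * x) * x ^ m = \<phi> x + c * \<phi> (of_real q * x)"
      using q_pos by (simp add: \<phi>_def c_def power_mult_distrib)
    finally show "qderiv q h x * x ^ Suc m = (1 / of_real (1 - q)) * (\<phi> x + c * \<phi> (of_real q * x))" .
  qed
  also have "\<dots> = (1 / of_real (1 - q)) * (I + c * (I / of_real q))"
    unfolding qintegral_cmult I_def
    using \<phi> rapid_cmult[OF rapid_scale[OF \<phi>], of c]
    by (simp add: qintegral_add rapid_qintegrable qintegral_cmult qintegral_scale[of \<phi>])
  finally have "qmoment q \<gamma> (Suc m) (qderiv q h)
      = of_real (q ^ (((Suc m)\<^sup>2 + Suc m) div 2)) * ((1 / of_real (1 - q)) * (I + c * (I / of_real q)))"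
    by (simp only: qmoment_def)
  \<comment> \<open>The exponent grows by \<open>m + 1\<close>: one factor \<open>q ^ m\<close>
    cancels the one in \<open>c\<close>, the last \<open>q\<close> the one from
    \<open>qintegral_scale\<close>.\<close>
  also have "((Suc m)\<^sup>2 + Suc m) div 2 = (m\<^sup>2 + m) div 2 + Suc m"
  proof -
    have "(Suc m)\<^sup>2 + Suc m = (m\<^sup>2 + m) + Suc m * 2" by (simp add: power2_eq_square)
    then show ?thesis by simp
  qed
  also have "complex_of_real (q ^ ((m\<^sup>2 + m) div 2 + Suc m)) * ((1 / of_real (1 - q)) * (I + c * (I / of_real q)))
      = - of_real (qnum q (Suc m)) * (of_real (q ^ ((m\<^sup>2 + m) div 2)) * I)"
  proof -
    have "complex_of_real (1 - q) \<noteq> 0" using q_less_1 by simp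
    then show ?thesis
      using q_pos by (simp add: qnum_def c_def power_add field_simps)
  qed
  finally show ?thesis by (simp add: qmoment_def I_def \<phi>_def[abs_def] del: of_real_power power_Suc)
qed

text \<open>The coefficients with which \<open>f\<close> acts in the convolution. In this
  normalization sign and q-factorial absorb the factor from integration by parts, and the
  q-derivative becomes a pure shift.\<close>

definition coef :: "(complex \<Rightarrow> complex) \<Rightarrow> nat \<Rightarrow> complex" where
  "coef f e = (-1) ^ e * qmoment q \<gamma> e f / of_real (qfact q e)"

lemma qnum_ge_1: "e > 0 \<Longrightarrow> 1 \<le> qnum q e"
  using q_pos q_less_1 power_decreasing[of 1 e q] by (simp add: qnum_def)

lemma qnum_le: "qnum q e \<le> 1 / (1 - q)"
  using q_pos q_less_1 by (simp add: qnum_def divide_right_mono)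

lemma qfact_Suc: "qfact q (Suc e) = qnum q (Suc e) * qfact q e"
  by (simp add: qfact_def prod.nat_ivl_Suc' mult.commute)

lemma qfact_ge_1: "1 \<le> qfact q e"
  unfolding qfact_def by (intro prod_ge_1 qnum_ge_1) auto

lemma qfact_le: "qfact q e \<le> (1 / (1 - q)) ^ e"
proof (induction e)
  case (Suc e)
  then show ?case
    unfolding qfact_Suc power_Suc
    using qnum_le qfact_ge_1[of e] q_less_1 by (intro mult_mono) auto
qed (simp add: qfact_def)

lemma coef_qderiv:
  assumes "nice h"
  shows "coef (qderiv q h) n = (case n of 0 \<Rightarrow> 0 | Suc m \<Rightarrow> coef h m)"
proof (cases n)
  case 0
  then show ?thesis by (simp add: coef_def qmoment_qderiv_0[OF assms])
next
  case (Suc m)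
  have "qnum q (Suc m) \<noteq> 0" using qnum_ge_1[of "Suc m"] by simp
  then show ?thesis
    using Suc by (simp add: coef_def qmoment_qderiv_Suc[OF assms] qfact_Suc)
qed

lemma coef_iter_deriv:
  assumes "nice h"
  shows "coef (iter_deriv e h) n = (if e \<le> n then coef h (n - e) else 0)"
proof (induction e arbitrary: n)
  case (Suc e)
  have "coef (iter_deriv (Suc e) h) n = (case n of 0 \<Rightarrow> 0 | Suc m \<Rightarrow> coef (iter_deriv e h) m)"
    using coef_qderiv[OF nice_iter_deriv[OF assms]] by simp
  then show ?case using Suc.IH by (cases n) auto
qed simp

text \<open>Applying \<open>e\<close> q-derivatives shifts the coefficients by \<open>e\<close>
  places, so only \<open>e \<le> n\<close> contributes to the \<open>n\<close>-th one and the series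
  collapses to a finite convolution.\<close>

lemma coef_qop:
  assumes g: "nice g" and a: "superexp a"
  shows "coef (qop a g) n = cauchy a (coef g) n"
proof -
  define c where "c = complex_of_real (q ^ ((n\<^sup>2 + n) div 2)) * (-1) ^ n / of_real (qfact q n)"
  have c: "coef f n = c * qintegral q \<gamma> (\<lambda>x. f x * x ^ n)" for f
    by (simp add: coef_def qmoment_def c_def)
  have "c \<noteq> 0" using q_pos qfact_ge_1[of n] by (simp add: c_def)
  have zero: "qintegral q \<gamma> (\<lambda>x. iter_deriv e g x * x ^ n) = 0" if "e > n" for e
    using c[of "iter_deriv e g"] coef_iter_deriv[OF g, of e n] that \<open>c \<noteq> 0\<close> by simp
  have "coef (qop a g) n = c * (\<Sum>e\<le>n. a e * qintegral q \<gamma> (\<lambda>x. iter_deriv e g x * x ^ n))"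
    unfolding c qintegral_qop[OF g a] using zero by (subst suminf_finite[of "{..n}"]) auto
  also have "\<dots> = (\<Sum>e\<le>n. a e * coef (iter_deriv e g) n)"
    by (simp add: sum_distrib_left c mult_ac)
  also have "\<dots> = cauchy a (coef g) n"
    by (simp add: coef_iter_deriv[OF g] cauchy_def)
  finally show ?thesis .
qed

section \<open>Gaussian decay\<close>

lemma gaussian_iff_bigo:
  "gaussian a \<longleftrightarrow> (\<exists>\<alpha>>0. \<exists>b>0. (\<lambda>e. norm (a e)) \<in> O(\<lambda>e. q powr (\<alpha> * (real e)\<^sup>2 / 2) * b ^ e))"
proof
  assume "gaussian a"
  then obtain p b C where a: "0 < p" "p < 1" "0 < b" "0 \<le> C" "\<And>e. norm (a e) \<le> C * p ^ (e * e) * b ^ e"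
    unfolding gaussian_def by metis
  define \<alpha> where "\<alpha> = 2 * (ln p / ln q)"
  have "\<alpha> > 0" using a q_pos q_less_1 by (simp add: \<alpha>_def zero_less_divide_iff)
  have "q powr (\<alpha> * (real e)\<^sup>2 / 2) = p ^ (e * e)" for e
  proof -
    have "q powr (\<alpha> * (real e)\<^sup>2 / 2) = exp (real (e * e) * ln p)"
      using q_pos q_less_1 by (simp add: powr_def \<alpha>_def power2_eq_square)
    then show ?thesis using a(1) by (simp only: exp_of_nat_mult exp_ln)
  qed
  then have "(\<lambda>e. norm (a e)) \<in> O(\<lambda>e. q powr (\<alpha> * (real e)\<^sup>2 / 2) * b ^ e)"
    using a by (intro bigoI[where c = C] always_eventually) (simp add: mult_ac)
  then show "\<exists>\<alpha>>0. \<exists>b>0. (\<lambda>e. norm (a e)) \<in> O(\<lambda>e. q powr (\<alpha> * (real e)\<^sup>2 / 2) * b ^ e)"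
    using \<open>\<alpha> > 0\<close> a(3) by blast
next
  assume "\<exists>\<alpha>>0. \<exists>b>0. (\<lambda>e. norm (a e)) \<in> O(\<lambda>e. q powr (\<alpha> * (real e)\<^sup>2 / 2) * b ^ e)"
  then obtain \<alpha> b where \<alpha>: "\<alpha> > 0" "b > 0"
    and O: "(\<lambda>e. norm (a e)) \<in> O(\<lambda>e. q powr (\<alpha> * (real e)\<^sup>2 / 2) * b ^ e)" by blast
  define p where "p = q powr (\<alpha> / 2)"
  have p: "0 < p" "p < 1"
    using q_pos q_less_1 \<alpha> powr_less_mono2[of "\<alpha> / 2" q 1] by (auto simp: p_def)
  have pow: "q powr (\<alpha> * (real e)\<^sup>2 / 2) = p ^ (e * e)" for e
    using q_pos by (simp add: p_def powr_powr power2_eq_square flip: powr_realpow)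
  obtain c where c: "c > 0" "eventually (\<lambda>e. norm (a e) \<le> c * (p ^ (e * e) * b ^ e)) sequentially"
    using O p \<alpha> unfolding pow bigo_def by (auto simp: abs_mult)
  \<comment> \<open>The comparison sequence is positive, so an eventual bound makes the quotient
    bounded for all \<open>e\<close>.\<close>
  have "Bseq (\<lambda>e. norm (a e) / (p ^ (e * e) * b ^ e))"
  proof (rule BfunI)
    show "eventually (\<lambda>e. norm (norm (a e) / (p ^ (e * e) * b ^ e)) \<le> c) sequentially"
      using c(2) by eventually_elim (use p \<alpha> in \<open>simp add: field_simps\<close>)
  qed
  then obtain C where "C > 0" "\<And>e. norm (norm (a e) / (p ^ (e * e) * b ^ e)) \<le> C"
    by (rule BseqE) blast
  then show "gaussian a"
    using p \<alpha> by (intro gaussianI[of p b C]) (auto simp: field_simps)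
qed

text \<open>The q-factorial lies between 1 and \<open>(1 / (1 - q)) ^ e\<close>, so dividing by it
  changes the sequence by at most an exponential factor.\<close>

lemma gaussian_coef_iff: "gaussian (coef f) \<longleftrightarrow> gaussian (\<lambda>e. qmoment q \<gamma> e f)"
proof
  have n: "norm (coef f e) * qfact q e = norm (qmoment q \<gamma> e f)" for e
    using qfact_ge_1[of e] by (simp add: coef_def norm_mult norm_divide norm_power)
  show "gaussian (\<lambda>e. qmoment q \<gamma> e f)" if "gaussian (coef f)"
  proof (rule gaussian_mult_exp[OF that, of "1 / (1 - q)" _ 1])
    show "norm (qmoment q \<gamma> e f) \<le> 1 * (1 / (1 - q)) ^ e * norm (coef f e)" for e
      unfolding n[symmetric] using mult_left_mono[OF qfact_le[of e], of "norm (coef f e)"] by (simp add: mult.commute)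
  qed (use q_less_1 in simp)
  show "gaussian (coef f)" if "gaussian (\<lambda>e. qmoment q \<gamma> e f)"
  proof (rule gaussian_mult_exp[OF that, of 1 _ 1])
    show "norm (coef f e) \<le> 1 * 1 ^ e * norm (qmoment q \<gamma> e f)" for e
      unfolding n[symmetric] using mult_left_mono[OF qfact_ge_1[of e], of "norm (coef f e)"] by simp
  qed simp
qed

section \<open>The function classes\<close>

lemma nice_cong:
  assumes "\<And>x. x \<in> L \<Longrightarrow> f x = g x"
  shows "nice f \<longleftrightarrow> nice g"
proof -
  have "rapid f \<longleftrightarrow> rapid g" unfolding rapid_def using assms by simp
  moreover have "extends S f \<longleftrightarrow> extends S g" for S unfolding extends_def using assms by simp
  ultimately show ?thesis unfolding nice_def by simp
qed

text \<open>The working description of the class: given an extension near 0, integrability against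
  all powers is the same as rapid decay, and the moment condition is Gaussian decay of the
  coefficients.\<close>

lemma HD_iff:
  "f \<in> HD_I_omega q \<gamma> \<longleftrightarrow> f \<in> funs_on L \<and> nice f \<and> gaussian (coef f)"
proof -
  have ext: "(\<exists>F. F holomorphic_on ball 0 r \<and> (\<forall>x\<in>L \<inter> ball 0 r. f x = F x)) \<longleftrightarrow> extends (ball 0 r) f" for r
    by (simp add: extends_def)
  have "f \<in> HD_I_omega q \<gamma> \<longleftrightarrow> (f \<in> I_infty q \<gamma> \<and> gaussian (coef f)) \<and> (\<exists>r>0. extends (ball 0 r) f)"
    unfolding HD_I_omega_def I_omega_def mem_Collect_eq gaussian_coef_iff[of f]
      gaussian_iff_bigo[of "\<lambda>e. qmoment q \<gamma> e f"] ext ..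
  moreover have "f \<in> funs_on L" if "f \<in> I_infty q \<gamma>"
    using that by (simp add: I_infty_def)
  ultimately show ?thesis
    unfolding nice_def using I_infty_rapid rapid_I_infty by blast
qed

abbreviation strip :: "real \<Rightarrow> complex set" where "strip a \<equiv> {z. \<bar>Im z\<bar> < a}"

lemma lattice_subset_strip: "0 < a \<Longrightarrow> L \<inter> strip a = L"
  by (auto dest: lattice_real)

lemma open_strip: "open (strip a)"
  by (intro open_Collect_less continuous_intros)

lemma convex_strip: "convex (strip a)"
proof -
  have "strip a = {z. Im z < a} \<inter> {z. Im z > - a}" by auto
  then show ?thesis by (simp add: convex_Int convex_halfspace_Im_lt convex_halfspace_Im_gt)
qed

lemma extends_subset: "extends S f \<Longrightarrow> T \<subseteq> S \<Longrightarrow> extends T f"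
  unfolding extends_def using holomorphic_on_subset by blast

text \<open>The disk of radius \<open>a\<close> lies in the strip of half-width \<open>a\<close>,
  and the strip contains the whole lattice because the lattice is real.\<close>

lemma HS_iff: "f \<in> HS_I_omega q \<gamma> \<longleftrightarrow> f \<in> HD_I_omega q \<gamma> \<and> (\<exists>a>0. extends (strip a) f)"
proof -
  have "ball 0 a \<subseteq> strip a" for a
  proof
    fix z :: complex assume "z \<in> ball 0 a"
    then show "z \<in> strip a" using abs_Im_le_cmod[of z] by simp
  qed
  then have ball: "extends (ball 0 a) f" if "extends (strip a) f" for a
    using extends_subset[OF that] by blast
  have strip: "(\<exists>F. F holomorphic_on strip a \<and> (\<forall>x\<in>L. f x = F x)) \<longleftrightarrow> extends (strip a) f" if "a > 0" for a
    unfolding extends_def lattice_subset_strip[OF that] ..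
  have "f \<in> HS_I_omega q \<gamma> \<longleftrightarrow> f \<in> I_omega q \<gamma> \<and> (\<exists>a>0. extends (strip a) f)"
    unfolding HS_I_omega_def mem_Collect_eq using strip by (intro conj_cong refl ex_cong1) simp_all
  moreover have "f \<in> HD_I_omega q \<gamma> \<longleftrightarrow> f \<in> I_omega q \<gamma> \<and> (\<exists>a>0. extends (ball 0 a) f)"
    unfolding HD_I_omega_def extends_def by simp
  ultimately show ?thesis using ball by blast
qed

section \<open>The convolution product\<close>

lemma iter_deriv_lincomb:
  assumes "x \<in> L"
  shows "iter_deriv e (\<lambda>y. c * f y + d * g y) x = c * iter_deriv e f x + d * iter_deriv e g x"
  using assms
proof (induction e arbitrary: x)
  case (Suc e)
  have "x \<noteq> 0" "of_real q * x \<in> L" using Suc.prems lattice_nonzero lattice_mult_q by auto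
  then show ?case
    using Suc by (simp add: qderiv_nonzero algebra_simps add_divide_distrib diff_divide_distrib)
qed simp

lemma qop_lincomb_right:
  assumes "nice f" "nice g" "superexp a" "x \<in> L"
  shows "qop a (\<lambda>y. c * f y + d * g y) x = c * qop a f x + d * qop a g x"
proof -
  have s: "summable (\<lambda>e. a e * iter_deriv e h x)" if "nice h" for h
    using summable_norm_cancel[OF summable_qop[OF that assms(3,4), of 0]] by simp
  have "qop a (\<lambda>y. c * f y + d * g y) x = (\<Sum>e. c * (a e * iter_deriv e f x) + d * (a e * iter_deriv e g x))"
    unfolding qop_def iter_deriv_lincomb[OF assms(4)] by (simp add: algebra_simps)
  also have "\<dots> = c * qop a f x + d * qop a g x"
    unfolding qop_def using s[OF assms(1)] s[OF assms(2)]
    by (simp add: suminf_add[symmetric] suminf_mult summable_mult)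
  finally show ?thesis .
qed

lemma qop_lincomb_left:
  assumes "nice g" "superexp a" "superexp b" "x \<in> L"
  shows "qop (\<lambda>e. c * a e + d * b e) g x = c * qop a g x + d * qop b g x"
proof -
  have s: "summable (\<lambda>e. a' e * iter_deriv e g x)" if "superexp a'" for a'
    using summable_norm_cancel[OF summable_qop[OF assms(1) that assms(4), of 0]] by simp
  have "qop (\<lambda>e. c * a e + d * b e) g x = (\<Sum>e. c * (a e * iter_deriv e g x) + d * (b e * iter_deriv e g x))"
    unfolding qop_def by (simp add: algebra_simps)
  also have "\<dots> = c * qop a g x + d * qop b g x"
    unfolding qop_def using s[OF assms(2)] s[OF assms(3)]
    by (simp add: suminf_add[symmetric] suminf_mult summable_mult)
  finally show ?thesis .
qed

lemma qop_cong:
  assumes "\<And>y. y \<in> L \<Longrightarrow> f y = g y" "x \<in> L"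
  shows "qop a f x = qop a g x"
proof -
  have "iter_deriv e f x = iter_deriv e g x" for e
    using iter_deriv_cong[of L f g x e] lattice_mult_q lattice_nonzero assms by blast
  then show ?thesis by (simp add: qop_def)
qed

text \<open>Both sides sum the absolutely convergent double family \<open>a e * b m\<close> times
  the q-derivative of order \<open>e + m\<close>: once iteratively, once along the diagonals
  \<open>e + m = n\<close>.\<close>

lemma qop_cauchy:
  assumes h: "nice h" and a: "superexp a" and b: "superexp b" and x: "x \<in> L"
  shows "qop (cauchy a b) h x = qop a (qop b h) x"
proof -
  obtain M D where MD: "0 \<le> M" "0 < D" "\<And>e x. x \<in> L \<Longrightarrow> norm x ^ 0 * norm (iter_deriv e h x) \<le> M * D ^ e"
    using nice_iter_deriv_bound[OF h, of 0] by metis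
  define t where "t e m = a e * (b m * iter_deriv (m + e) h x)" for e m
  have "summable (\<lambda>e. norm (a e) * D ^ e)" "summable (\<lambda>e. norm (b e) * D ^ e)"
    using a b MD(2) by (auto simp: superexp_def)
  then have sum_ab: "(\<lambda>e. norm (a e) * D ^ e) summable_on UNIV" "(\<lambda>m. M * (norm (b m) * D ^ m)) summable_on UNIV"
    using MD by (auto intro!: summable_on_cmult_right simp: summable_on_UNIV_nonneg_real_iff)
  have joint: "(\<lambda>(e, m). t e m) summable_on UNIV \<times> UNIV"
  proof (rule summable_on_product_bound[OF sum_ab(1) _ sum_ab(2)])
    fix e m
    have "norm (t e m) \<le> norm (a e) * (norm (b m) * (M * D ^ (m + e)))"
      unfolding t_def norm_mult using MD(3)[OF x, of "m + e"] by (intro mult_left_mono) auto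
    then show "norm (t e m) \<le> norm (a e) * D ^ e * (M * (norm (b m) * D ^ m))"
      by (simp add: power_add mult_ac)
  qed (use MD in auto)
  have inner: "infsum (t e) UNIV = a e * iter_deriv e (qop b h) x" for e
  proof -
    have "t e summable_on UNIV" using summable_on_SigmaD1[OF joint, of e] by simp
    then have "infsum (t e) UNIV = suminf (t e)" by (rule infsum_nat_suminf)
    also have "\<dots> = a e * (\<Sum>m. b m * iter_deriv (m + e) h x)"
      unfolding t_def by (rule suminf_mult) (rule summable_norm_cancel[OF summable_qop[OF h b x]])
    finally show ?thesis unfolding iter_deriv_qop[OF h b x] .
  qed
  have "qop a (qop b h) x = (\<Sum>e. infsum (t e) UNIV)"
    unfolding inner qop_def ..
  also have "\<dots> = infsum (\<lambda>(e, m). t e m) (UNIV \<times> UNIV)"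
    using infsum_nat_suminf(2)[OF summable_on_Sigma_banach[OF joint]] infsum_Sigma'_banach[OF joint] by simp
  finally have rhs: "qop a (qop b h) x = infsum (\<lambda>(e, m). t e m) (UNIV \<times> UNIV)" .
  define T where "T = (SIGMA n:UNIV. {..n::nat})"
  \<comment> \<open>Indexes the pairs by their diagonal \<open>n\<close> and their first entry
    \<open>e\<close>.\<close>
  define s where "s = (\<lambda>(n::nat, e::nat). (e, n - e))"
  have s: "bij_betw s T (UNIV \<times> UNIV)"
    unfolding T_def s_def by (rule bij_betwI[where g = "\<lambda>(e, m). (e + m, e)"]) auto
  have s_t: "(\<lambda>z. (\<lambda>(e, m). t e m) (s z)) = (\<lambda>(n, e). t e (n - e))"
    by (auto simp: s_def)
  have diag: "(\<lambda>(n, e). t e (n - e)) summable_on T"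
    using joint summable_on_reindex_bij_betw[OF s, of "\<lambda>(e, m). t e m"] unfolding s_t by simp
  have term_eq: "infsum (\<lambda>e. t e (n - e)) {..n} = cauchy a b n * iter_deriv n h x" for n
    by (simp add: t_def cauchy_def sum_distrib_right mult.assoc)
  have "infsum (\<lambda>(e, m). t e m) (UNIV \<times> UNIV) = infsum (\<lambda>(n, e). t e (n - e)) T"
    using infsum_reindex_bij_betw[OF s, of "\<lambda>(e, m). t e m"] unfolding s_t by simp
  also have "\<dots> = infsum (\<lambda>n. infsum (\<lambda>e. t e (n - e)) {..n}) UNIV"
    using infsum_Sigma'_banach[OF diag[unfolded T_def]] by (simp add: T_def)
  also have "\<dots> = (\<Sum>n. infsum (\<lambda>e. t e (n - e)) {..n})"
    by (rule infsum_nat_suminf) (rule summable_on_Sigma_banach[OF diag[unfolded T_def]])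
  also have "\<dots> = qop (cauchy a b) h x"
    unfolding term_eq qop_def ..
  finally show ?thesis using rhs by simp
qed

lemma coef_cong:
  assumes "\<And>x. x \<in> L \<Longrightarrow> f x = g x"
  shows "coef f e = coef g e"
  using qintegral_cong[of "\<lambda>x. f x * x ^ e" "\<lambda>x. g x * x ^ e"] assms
  by (simp add: coef_def qmoment_def)

lemma coef_lincomb:
  assumes "rapid f" "rapid g"
  shows "coef (\<lambda>x. c * f x + d * g x) e = c * coef f e + d * coef g e"
proof -
  have "qintegral q \<gamma> (\<lambda>x. (c * f x + d * g x) * x ^ e)
      = qintegral q \<gamma> (\<lambda>x. c * (f x * x ^ e) + d * (g x * x ^ e))"
    by (simp add: algebra_simps)
  also have "\<dots> = c * qintegral q \<gamma> (\<lambda>x. f x * x ^ e) + d * qintegral q \<gamma> (\<lambda>x. g x * x ^ e)"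
    using assms by (simp add: qintegral_add qintegral_cmult rapid_qintegrable rapid_cmult rapid_mult_power)
  finally show ?thesis
    by (simp add: coef_def qmoment_def algebra_simps add_divide_distrib)
qed

section \<open>Linear structure of the two classes\<close>

lemma extends_lincomb:
  assumes "extends S f" "extends S g"
  shows "extends S (\<lambda>x. c * f x + d * g x)"
proof -
  obtain F G where "F holomorphic_on S" "\<forall>x\<in>L \<inter> S. f x = F x" "G holomorphic_on S" "\<forall>x\<in>L \<inter> S. g x = G x"
    using assms unfolding extends_def by blast
  then show ?thesis
    unfolding extends_def by (intro exI[of _ "\<lambda>x. c * F x + d * G x"]) (auto intro!: holomorphic_intros)
qed

lemma nice_lincomb:
  assumes "nice f" "nice g"
  shows "nice (\<lambda>x. c * f x + d * g x)"
proof -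
  obtain r r' where "r > 0" "extends (ball 0 r) f" "r' > 0" "extends (ball 0 r') g"
    using assms unfolding nice_def by blast
  then have "min r r' > 0 \<and> extends (ball 0 (min r r')) (\<lambda>x. c * f x + d * g x)"
    by (auto intro!: extends_lincomb intro: extends_subset)
  moreover have "rapid (\<lambda>x. c * f x + d * g x)"
    using assms by (intro rapid_add rapid_cmult) (auto simp: nice_def)
  ultimately show ?thesis unfolding nice_def by blast
qed

lemma HD_zero: "(\<lambda>x. 0) \<in> HD_I_omega q \<gamma>"
proof -
  have "extends (ball 0 1) (\<lambda>x. 0)" unfolding extends_def by (intro exI[of _ "\<lambda>x. 0"]) auto
  then have nice: "nice (\<lambda>x. 0)" unfolding nice_def rapid_def by (auto intro: exI[of _ 1])
  have "qint_term q \<gamma> (\<lambda>x. 0) = (\<lambda>p. 0)" by (auto simp: qint_term_def)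
  then have "gaussian (coef (\<lambda>x. 0))"
    by (intro gaussianI[of "1 / 2" 1 0]) (simp_all add: coef_def qmoment_def qintegral_def)
  then show ?thesis using nice by (simp add: HD_iff funs_on_def)
qed

lemma HD_lincomb:
  assumes "f \<in> HD_I_omega q \<gamma>" "g \<in> HD_I_omega q \<gamma>"
  shows "(\<lambda>x. c * f x + d * g x) \<in> HD_I_omega q \<gamma>"
proof -
  have f: "f \<in> funs_on L" "nice f" "gaussian (coef f)" and g: "g \<in> funs_on L" "nice g" "gaussian (coef g)"
    using assms by (auto simp: HD_iff)
  have "gaussian (\<lambda>e. c * coef f e)" "gaussian (\<lambda>e. d * coef g e)"
    using gaussian_mult_exp[OF f(3), of 1 _ "norm c"] gaussian_mult_exp[OF g(3), of 1 _ "norm d"]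
    by (auto simp: norm_mult)
  then have "gaussian (\<lambda>e. c * coef f e + d * coef g e)" by (rule gaussian_add)
  moreover have "coef (\<lambda>x. c * f x + d * g x) = (\<lambda>e. c * coef f e + d * coef g e)"
    using f g by (intro ext coef_lincomb) (auto simp: nice_def)
  ultimately show ?thesis
    using f g nice_lincomb by (simp add: HD_iff funs_on_def)
qed

lemma HS_zero: "(\<lambda>x. 0) \<in> HS_I_omega q \<gamma>"
proof -
  have "extends (strip 1) (\<lambda>x. 0)" unfolding extends_def by (intro exI[of _ "\<lambda>x. 0"]) auto
  then show ?thesis using HD_zero unfolding HS_iff by (auto intro: exI[of _ 1])
qed

lemma HS_lincomb:
  assumes "f \<in> HS_I_omega q \<gamma>" "g \<in> HS_I_omega q \<gamma>"
  shows "(\<lambda>x. c * f x + d * g x) \<in> HS_I_omega q \<gamma>"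
proof -
  obtain r r' where r: "r > 0" "extends (strip r) f" "r' > 0" "extends (strip r') g"
    using assms unfolding HS_iff by blast
  have "strip (min r r') \<subseteq> strip r" "strip (min r r') \<subseteq> strip r'" by auto
  then have "min r r' > 0 \<and> extends (strip (min r r')) (\<lambda>x. c * f x + d * g x)"
    using r extends_subset by (intro conjI extends_lincomb) auto
  moreover have "(\<lambda>x. c * f x + d * g x) \<in> HD_I_omega q \<gamma>"
    using assms by (intro HD_lincomb) (auto simp: HS_iff)
  ultimately show ?thesis unfolding HS_iff by blast
qed

section \<open>The convolution on the two classes\<close>

lemma qconv_term_eq: "qconv_term q \<gamma> f g x e = coef f e * iter_deriv e g x"
  by (simp add: qconv_term_def coef_def)

lemma qconv_eq: "qconv q \<gamma> f g x = (if x \<in> L then qop (coef f) g x else 0)"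
  by (simp add: qconv_def qop_def qconv_term_eq[abs_def])

lemma HD_qconv_converges:
  assumes "f \<in> HD_I_omega q \<gamma>" "g \<in> HD_I_omega q \<gamma>" "x \<in> L"
  shows "qconv_converges q \<gamma> f g x"
  using summable_qop[of g "coef f" x 0] assms
  by (simp add: HD_iff gaussian_superexp qconv_converges_def qconv_term_eq)

lemma coef_qconv:
  assumes "f \<in> HD_I_omega q \<gamma>" "g \<in> HD_I_omega q \<gamma>"
  shows "coef (qconv q \<gamma> f g) = cauchy (coef f) (coef g)"
proof
  fix n
  have "coef (qconv q \<gamma> f g) n = coef (qop (coef f) g) n"
    by (rule coef_cong) (simp add: qconv_eq)
  then show "coef (qconv q \<gamma> f g) n = cauchy (coef f) (coef g) n"
    using assms by (simp add: coef_qop HD_iff gaussian_superexp)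
qed

lemma HD_qconv:
  assumes "f \<in> HD_I_omega q \<gamma>" "g \<in> HD_I_omega q \<gamma>"
  shows "qconv q \<gamma> f g \<in> HD_I_omega q \<gamma>"
proof -
  have "nice (qop (coef f) g)"
    using assms by (simp add: HD_iff nice_qop gaussian_superexp)
  then have "nice (qconv q \<gamma> f g)"
    using nice_cong[of "qconv q \<gamma> f g" "qop (coef f) g"] by (simp add: qconv_eq)
  moreover have "gaussian (coef (qconv q \<gamma> f g))"
    unfolding coef_qconv[OF assms] using assms by (simp add: HD_iff gaussian_cauchy)
  ultimately show ?thesis by (simp add: HD_iff funs_on_def qconv_eq)
qed

text \<open>Only the right factor is differentiated, so it alone determines where the product
  extends; the left factor contributes nothing but its coefficients.\<close>

lemma HS_qconv:
  assumes f: "f \<in> HD_I_omega q \<gamma>" and g: "g \<in> HS_I_omega q \<gamma>"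
  shows "qconv q \<gamma> f g \<in> HS_I_omega q \<gamma>"
proof -
  obtain r where r: "r > 0" "extends (strip r) g" using g unfolding HS_iff by blast
  have "extends (strip r) (qop (coef f) g)"
    using r f by (intro extends_qop open_strip convex_strip) (auto simp: HD_iff gaussian_superexp)
  then have "extends (strip r) (qconv q \<gamma> f g)"
    unfolding extends_def by (simp add: qconv_eq)
  then show ?thesis
    using r(1) f g HD_qconv unfolding HS_iff by blast
qed

text \<open>On the lattice both sides equal \<open>qop (coef f) (qop (coef g) h)\<close>, and off it
  both vanish.\<close>

lemma qconv_assoc:
  assumes f: "f \<in> HD_I_omega q \<gamma>" and g: "g \<in> HD_I_omega q \<gamma>" and h: "h \<in> HD_I_omega q \<gamma>"
  shows "qconv q \<gamma> (qconv q \<gamma> f g) h = qconv q \<gamma> f (qconv q \<gamma> g h)"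
proof
  fix x
  have "qop (coef (qconv q \<gamma> f g)) h x = qop (coef f) (qconv q \<gamma> g h) x" if x: "x \<in> L"
  proof -
    have "qop (coef (qconv q \<gamma> f g)) h x = qop (coef f) (qop (coef g) h) x"
      unfolding coef_qconv[OF f g] using f g h x by (intro qop_cauchy) (auto simp: HD_iff gaussian_superexp)
    also have "\<dots> = qop (coef f) (qconv q \<gamma> g h) x"
      using x by (intro qop_cong) (auto simp: qconv_eq)
    finally show ?thesis .
  qed
  then show "qconv q \<gamma> (qconv q \<gamma> f g) h x = qconv q \<gamma> f (qconv q \<gamma> g h) x"
    by (simp add: qconv_eq[of _ _ x])
qed

lemma qconv_lincomb_left:
  assumes "f \<in> HD_I_omega q \<gamma>" "g \<in> HD_I_omega q \<gamma>" "h \<in> HD_I_omega q \<gamma>"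
  shows "qconv q \<gamma> (\<lambda>x. c * f x + d * g x) h = (\<lambda>x. c * qconv q \<gamma> f h x + d * qconv q \<gamma> g h x)"
proof
  fix x
  have "coef (\<lambda>x. c * f x + d * g x) = (\<lambda>e. c * coef f e + d * coef g e)"
    using assms by (intro ext coef_lincomb) (auto simp: HD_iff nice_def)
  then show "qconv q \<gamma> (\<lambda>x. c * f x + d * g x) h x = c * qconv q \<gamma> f h x + d * qconv q \<gamma> g h x"
    using assms by (simp add: qconv_eq qop_lincomb_left HD_iff gaussian_superexp)
qed

lemma qconv_lincomb_right:
  assumes "f \<in> HD_I_omega q \<gamma>" "g \<in> HD_I_omega q \<gamma>" "h \<in> HD_I_omega q \<gamma>"
  shows "qconv q \<gamma> f (\<lambda>x. c * g x + d * h x) = (\<lambda>x. c * qconv q \<gamma> f g x + d * qconv q \<gamma> f h x)"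
  using assms by (simp add: fun_eq_iff qconv_eq qop_lincomb_right HD_iff gaussian_superexp)

text \<open>The identities hold on the larger class, so any linear subspace of it closed under the
  product is an algebra. It is applied to both classes.\<close>

lemma assoc_algebra_qconv:
  assumes sub: "A \<subseteq> HD_I_omega q \<gamma>" and zero: "(\<lambda>x. 0) \<in> A"
    and lincomb: "\<And>f g c d. f \<in> A \<Longrightarrow> g \<in> A \<Longrightarrow> (\<lambda>x. c * f x + d * g x) \<in> A"
    and mult: "\<And>f g. f \<in> A \<Longrightarrow> g \<in> A \<Longrightarrow> qconv q \<gamma> f g \<in> A"
  shows "assoc_algebra fun_scale A (qconv q \<gamma>)"
proof -
  interpret vector_space fun_scale
    by unfold_locales (auto simp: fun_scale_def algebra_simps)
  \<comment> \<open>Sums and scalar multiples are both written as linear combinations, so that one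
    family of lemmas yields additivity and homogeneity.\<close>
  have plus: "f + g = (\<lambda>x. 1 * f x + 1 * g x)" and scale: "fun_scale c f = (\<lambda>x. c * f x + 0 * f x)"
    for f g :: "complex \<Rightarrow> complex" and c
    by (auto simp: fun_scale_def)
  show ?thesis
  proof
    show "subspace A"
      unfolding subspace_def plus scale
      using zero by (intro conjI ballI allI lincomb) (simp_all add: zero_fun_def)
    fix a b c assume "a \<in> A" "b \<in> A"
    then have ab: "a \<in> HD_I_omega q \<gamma>" "b \<in> HD_I_omega q \<gamma>" using sub by auto
    show "qconv q \<gamma> a b \<in> A" using mult \<open>a \<in> A\<close> \<open>b \<in> A\<close> .
    show "qconv q \<gamma> (fun_scale r a) b = fun_scale r (qconv q \<gamma> a b)" for r
      unfolding scale by (rule qconv_lincomb_left[OF ab(1) ab(1) ab(2)])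
    show "qconv q \<gamma> a (fun_scale r b) = fun_scale r (qconv q \<gamma> a b)" for r
      unfolding scale by (rule qconv_lincomb_right[OF ab ab(2)])
    assume "c \<in> A"
    then have c: "c \<in> HD_I_omega q \<gamma>" using sub by auto
    show "qconv q \<gamma> (a + b) c = qconv q \<gamma> a c + qconv q \<gamma> b c"
      unfolding plus by (rule qconv_lincomb_left[OF ab c])
    show "qconv q \<gamma> a (b + c) = qconv q \<gamma> a b + qconv q \<gamma> a c"
      unfolding plus by (rule qconv_lincomb_right[OF ab c])
    show "qconv q \<gamma> (qconv q \<gamma> a b) c = qconv q \<gamma> a (qconv q \<gamma> b c)"
      by (rule qconv_assoc[OF ab c])
  qed
qed

end

theorem corollary4p9:
  fixes q \<gamma> :: real
  assumes "0 < q" and "q < 1" and "0 < \<gamma>"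
  shows "(\<forall>f \<in> HD_I_omega q \<gamma>. \<forall>g \<in> HD_I_omega q \<gamma>. \<forall>x \<in> qlattice q \<gamma>. qconv_converges q \<gamma> f g x) \<and>
    assoc_algebra fun_scale (HD_I_omega q \<gamma>) (qconv q \<gamma>) \<and>
    HS_I_omega q \<gamma> \<subseteq> HD_I_omega q \<gamma> \<and>
    assoc_algebra fun_scale (HS_I_omega q \<gamma>) (qconv q \<gamma>) \<and>
    algebra_left_ideal fun_scale (HD_I_omega q \<gamma>) (qconv q \<gamma>) (HS_I_omega q \<gamma>)"
proof -
  interpret q_lattice q \<gamma> using assms by unfold_locales
  have sub: "HS_I_omega q \<gamma> \<subseteq> HD_I_omega q \<gamma>" using HS_iff by blast
  have HD: "assoc_algebra fun_scale (HD_I_omega q \<gamma>) (qconv q \<gamma>)"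
    using HD_zero HD_lincomb HD_qconv by (intro assoc_algebra_qconv) auto
  have HS: "assoc_algebra fun_scale (HS_I_omega q \<gamma>) (qconv q \<gamma>)"
    using HS_zero HS_lincomb HS_qconv sub by (intro assoc_algebra_qconv) auto
  have "algebra_left_ideal fun_scale (HD_I_omega q \<gamma>) (qconv q \<gamma>) (HS_I_omega q \<gamma>)"
    unfolding algebra_left_ideal_def algebra_left_ideal_axioms_def
    using HD sub assoc_algebra.subspace_carrier[OF HS] HS_qconv by blast
  then show ?thesis using HD HS sub HD_qconv_converges by blast
qed

end
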